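(* A weighted composition operator $C_{w,f}$ on $L^p(\mu)$ is distributionally chaotic if and only if there exists a nonempty countable family $(B_i)_{i \in I}$ of measurable sets of finite positive $\mu$-measure such that the following properties hold: (a) There exists a set $D \subset \mathbb{N}$ with $\overline{\mathrm{dens}}(D) = 1$ such that \[ \lim_{n \in D} \mu_n(f^{-n}(B_i)) = 0 \quad \text{for all } i \in I. \] (b) There exist $\varepsilon > 0$ and an increasing sequence $(N_k)_{k \in \mathbb{N}}$ of positive integers such that, for each $k \in \mathbb{N}$, there are $r \in \mathbb{N}$, $i_1,\ldots,i_r \in I$ and $b_1,\ldots,b_r \in (0,\infty)$ with \[ \mathrm{card}\Big\{1 \le n \le N_k : \frac{b_1 \mu_n(f^{-n}(B_{i_1})) + \cdots + b_r \mu_n(f^{-n}(B_{i_r}))}{b_1 \mu(B_{i_1}) + \cdots + b_r \mu(B_{i_r})} > k \Big\} \ge \varepsilon N_k. \]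
   Context: Fix $\mathbb{K} = \mathbb{R}$ or $\mathbb{C}$, a real number $p \in [1,\infty)$ and an arbitrary positive measure space $(X,\mathfrak{M},\mu)$. $L^p(\mu)$ is the Banach space over $\mathbb{K}$ of all $\mathbb{K}$-valued $p$-integrable functions with norm $\|\varphi\|_p = (\int_X |\varphi|^p d\mu)^{1/p}$. A weighted composition operator on $L^p(\mu)$ is the map $C_{w,f}(\varphi) = (\varphi \circ f)\cdot w$, where $w : X \to \mathbb{K}$ is measurable with $\varphi\cdot w \in L^p(\mu)$ for all $\varphi \in L^p(\mu)$, $f : X \to X$ is bimeasurable (i.e. $f(B) \in \mathfrak{M}$ and $f^{-1}(B) \in \mathfrak{M}$ whenever $B \in \mathfrak{M}$), and there is a constant $c \in (0,\infty)$ such that $\int_B |w|^p d\mu \le c\,\mu(f(B))$ for every $B \in \mathfrak{M}$; these conditions make $C_{w,f}$ a well-defined bounded linear operator on $L^p(\mu)$. Put $w^{(1)} = w$, $w^{(n)} = (w\circ f^{n-1})\cdots(w\circ f)\cdot w$ for $n \ge 2$, and $\mu_n(B) = \int_B |w^{(n)}|^p d\mu$ for $B \in \mathfrak{M}$, $n \in \mathbb{N} = \{1,2,\ldots\}$. For $D \subset \mathbb{N}$, $\underline{\mathrm{dens}}(D) = \liminf_{n\to\infty} \frac{\mathrm{card}(D\cap[1,n])}{n}$ and $\overline{\mathrm{dens}}(D) = \limsup_{n\to\infty} \frac{\mathrm{card}(D\cap[1,n])}{n}$. $\lim_{n\in D}$ denotes the limit as $n \to \infty$ along $n \in D$. A map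 $g : M \to M$ on a metric space $(M,d)$ is distributionally chaotic if there exist an uncountable set $\Gamma \subset M$ and $\varepsilon > 0$ such that for each pair $(x,y)$ of distinct points of $\Gamma$: $\underline{\mathrm{dens}}\{n \in \mathbb{N} : d(g^n(x),g^n(y)) < \varepsilon\} = 0$ and $\overline{\mathrm{dens}}\{n \in \mathbb{N} : d(g^n(x),g^n(y)) < \tau\} = 1$ for all $\tau > 0$. *)

theory Defs
  imports "HOL-Analysis.Analysis"
begin

text \<open>Densities refer to the positive integers, so the element \<open>0\<close> of a set of type
  \<^typ>\<open>nat set\<close> is never counted. The term with \<open>n = 0\<close> does not affect the limits.\<close>

definition lower_dens :: "nat set \<Rightarrow> ereal" where
  "lower_dens D = liminf (\<lambda>n. ereal (real (card (D \<inter> {1..n})) / real n))"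

definition upper_dens :: "nat set \<Rightarrow> ereal" where
  "upper_dens D = limsup (\<lambda>n. ereal (real (card (D \<inter> {1..n})) / real n))"

definition distributionally_chaotic ::
  "'m set \<Rightarrow> ('m \<Rightarrow> 'm \<Rightarrow> real) \<Rightarrow> ('m \<Rightarrow> 'm) \<Rightarrow> bool" where
  "distributionally_chaotic S d g \<longleftrightarrow>
     (\<exists>\<Gamma> \<epsilon>. \<Gamma> \<subseteq> S \<and> uncountable \<Gamma> \<and> \<epsilon> > 0 \<and>
        (\<forall>x\<in>\<Gamma>. \<forall>y\<in>\<Gamma>. x \<noteq> y \<longrightarrow>
           lower_dens {n. 1 \<le> n \<and> d ((g ^^ n) x) ((g ^^ n) y) < \<epsilon>} = 0 \<and>
           (\<forall>\<tau>>0. upper_dens {n. 1 \<le> n \<and> d ((g ^^ n) x) ((g ^^ n) y) < \<tau>} = 1)))"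

text \<open>The scalar field is a type \<open>'k\<close>. A finite-dimensional real normed field, i.e. a type of
  class \<open>real_normed_field\<close> and \<open>euclidean_space\<close>, is isometrically isomorphic to \<^typ>\<open>real\<close> or
  \<^typ>\<open>complex\<close>, and both types are instances; so quantifying over such \<open>'k\<close> covers exactly
  the real and the complex case.\<close>

definition Lp_fun :: "real \<Rightarrow> 'a measure \<Rightarrow> ('a \<Rightarrow> 'k::real_normed_vector) set" where
  "Lp_fun p M = {\<phi> \<in> borel_measurable M. integrable M (\<lambda>x. norm (\<phi> x) powr p)}"

definition Lp_norm :: "real \<Rightarrow> 'a measure \<Rightarrow> ('a \<Rightarrow> 'k::real_normed_vector) \<Rightarrow> real" where
  "Lp_norm p M \<phi> = (LINT x|M. norm (\<phi> x) powr p) powr (1 / p)"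

definition Lp_eq :: "real \<Rightarrow> 'a measure \<Rightarrow> ('a \<Rightarrow> 'k::real_normed_vector) rel" where
  "Lp_eq p M = {(\<phi>, \<psi>). \<phi> \<in> Lp_fun p M \<and> \<psi> \<in> Lp_fun p M \<and> (AE x in M. \<phi> x = \<psi> x)}"

definition Lp_space :: "real \<Rightarrow> 'a measure \<Rightarrow> ('a \<Rightarrow> 'k::real_normed_vector) set set" where
  "Lp_space p M = Lp_fun p M // Lp_eq p M"

text \<open>The value does not depend on the representatives; see \<open>Lp_dist_class\<close> below.\<close>

definition Lp_dist ::
  "real \<Rightarrow> 'a measure \<Rightarrow> ('a \<Rightarrow> 'k::real_normed_vector) set \<Rightarrow> ('a \<Rightarrow> 'k) set \<Rightarrow> real" where
  "Lp_dist p M F G = (THE r. \<exists>\<phi>\<in>F. \<exists>\<psi>\<in>G. r = Lp_norm p M (\<lambda>x. \<phi> x - \<psi> x))"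

definition weighted_composition ::
  "real \<Rightarrow> 'a measure \<Rightarrow> ('a \<Rightarrow> 'k::real_normed_field) \<Rightarrow> ('a \<Rightarrow> 'a) \<Rightarrow> bool" where
  "weighted_composition p M w f \<longleftrightarrow>
     w \<in> borel_measurable M \<and>
     (\<forall>\<phi>\<in>Lp_fun p M. (\<lambda>x. \<phi> x * w x) \<in> Lp_fun p M) \<and>
     f \<in> measurable M M \<and> (\<forall>B\<in>sets M. f ` B \<in> sets M) \<and>
     (\<exists>c::real. c > 0 \<and>
        (\<forall>B\<in>sets M. (\<integral>\<^sup>+x\<in>B. ennreal (norm (w x) powr p) \<partial>M) \<le> ennreal c * emeasure M (f ` B)))"

text \<open>The operator on classes: it sends the class of \<open>\<phi>\<close> to the class of \<open>(\<phi> \<circ> f) \<cdot> w\<close>;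
  see \<open>wcomp_op_class\<close> below.\<close>

definition wcomp_op ::
  "real \<Rightarrow> 'a measure \<Rightarrow> ('a \<Rightarrow> 'k::real_normed_field) \<Rightarrow> ('a \<Rightarrow> 'a) \<Rightarrow> ('a \<Rightarrow> 'k) set \<Rightarrow> ('a \<Rightarrow> 'k) set"
  where
  "wcomp_op p M w f F = {\<psi> \<in> Lp_fun p M. \<exists>\<phi>\<in>F. AE x in M. \<psi> x = \<phi> (f x) * w x}"

definition weight_iter :: "('a \<Rightarrow> 'k::real_normed_field) \<Rightarrow> ('a \<Rightarrow> 'a) \<Rightarrow> nat \<Rightarrow> 'a \<Rightarrow> 'k" where
  "weight_iter w f n x = (\<Prod>j<n. w ((f ^^ j) x))"

definition mu_iter ::
  "real \<Rightarrow> 'a measure \<Rightarrow> ('a \<Rightarrow> 'k::real_normed_field) \<Rightarrow> ('a \<Rightarrow> 'a) \<Rightarrow> nat \<Rightarrow> 'a set \<Rightarrow> ennreal" where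
  "mu_iter p M w f n B = (\<integral>\<^sup>+x\<in>B. ennreal (norm (weight_iter w f n x) powr p) \<partial>M)"

definition preimage_iter :: "'a measure \<Rightarrow> ('a \<Rightarrow> 'a) \<Rightarrow> nat \<Rightarrow> 'a set \<Rightarrow> 'a set" where
  "preimage_iter M f n B = (f ^^ n) -` B \<inter> space M"

lemma equiv_Lp_eq: "equiv (Lp_fun p M) (Lp_eq p M)"
  unfolding Lp_eq_def by (rule equivI) (auto simp: refl_on_def sym_def trans_def elim: AE_mp)

lemma Lp_dist_class:
  fixes \<phi> \<psi> :: "'a \<Rightarrow> 'k::{real_normed_vector, second_countable_topology}"
  assumes "\<phi> \<in> Lp_fun p M" "\<psi> \<in> Lp_fun p M"
  shows "Lp_dist p M (Lp_eq p M `` {\<phi>}) (Lp_eq p M `` {\<psi>}) = Lp_norm p M (\<lambda>x. \<phi> x - \<psi> x)"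
proof -
  have "Lp_norm p M (\<lambda>x. \<phi>' x - \<psi>' x) = Lp_norm p M (\<lambda>x. \<phi> x - \<psi> x)"
    if "\<phi>' \<in> Lp_eq p M `` {\<phi>}" "\<psi>' \<in> Lp_eq p M `` {\<psi>}" for \<phi>' \<psi>'
  proof -
    have [measurable]: "\<phi> \<in> borel_measurable M" "\<psi> \<in> borel_measurable M"
        "\<phi>' \<in> borel_measurable M" "\<psi>' \<in> borel_measurable M"
      and ae: "AE x in M. \<phi> x = \<phi>' x" "AE x in M. \<psi> x = \<psi>' x"
      using that assms by (auto simp: Lp_eq_def Lp_fun_def)
    have "(LINT x|M. norm (\<phi>' x - \<psi>' x) powr p) = (LINT x|M. norm (\<phi> x - \<psi> x) powr p)"
      using ae by (intro integral_cong_AE) auto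
    then show ?thesis by (simp add: Lp_norm_def)
  qed
  moreover have "\<phi> \<in> Lp_eq p M `` {\<phi>}" "\<psi> \<in> Lp_eq p M `` {\<psi>}"
    using assms by (auto simp: Lp_eq_def)
  ultimately show ?thesis
    unfolding Lp_dist_def by (intro the_equality) blast+
qed

lemma wcomp_Lp:
  fixes w :: "'a \<Rightarrow> 'k::{real_normed_field, second_countable_topology}"
  assumes "weighted_composition p M w f" "\<phi> \<in> Lp_fun p M"
  shows "(\<lambda>x. \<phi> (f x) * w x) \<in> Lp_fun p M"
proof -
  from assms obtain c where [measurable]: "w \<in> borel_measurable M" "f \<in> measurable M M"
      "\<phi> \<in> borel_measurable M"
    and im: "\<And>B. B \<in> sets M \<Longrightarrow> f ` B \<in> sets M" and c: "c > 0"
    and le: "\<And>B. B \<in> sets M \<Longrightarrow>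
      (\<integral>\<^sup>+x\<in>B. ennreal (norm (w x) powr p) \<partial>M) \<le> ennreal c * emeasure M (f ` B)"
    and int: "integrable M (\<lambda>x. norm (\<phi> x) powr p)"
    by (auto simp: weighted_composition_def Lp_fun_def)
  let ?\<nu> = "distr (density M (\<lambda>x. ennreal (norm (w x) powr p))) M f"
  have "?\<nu> \<le> scale_measure (ennreal c) M"
  proof (subst le_measure)
    show "\<forall>A\<in>sets ?\<nu>. emeasure ?\<nu> A \<le> emeasure (scale_measure (ennreal c) M) A"
    proof
      fix A assume "A \<in> sets ?\<nu>"
      then have [measurable]: "A \<in> sets M" by simp
      have pre: "f -` A \<inter> space M \<in> sets M" by measurable
      have "emeasure ?\<nu> A = (\<integral>\<^sup>+x\<in>f -` A \<inter> space M. ennreal (norm (w x) powr p) \<partial>M)"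
        using pre by (simp add: emeasure_distr emeasure_density)
      also have "\<dots> \<le> ennreal c * emeasure M (f ` (f -` A \<inter> space M))"
        by (rule le[OF pre])
      also have "\<dots> \<le> ennreal c * emeasure M A"
        by (intro mult_left_mono emeasure_mono) auto
      finally show "emeasure ?\<nu> A \<le> emeasure (scale_measure (ennreal c) M) A" by simp
    qed
  qed simp
  then have "(\<integral>\<^sup>+x. ennreal (norm (\<phi> x) powr p) \<partial>?\<nu>)
      \<le> (\<integral>\<^sup>+x. ennreal (norm (\<phi> x) powr p) \<partial>scale_measure (ennreal c) M)"
    by (intro nn_integral_mono_measure) auto
  also have "\<dots> = ennreal c * (\<integral>\<^sup>+x. ennreal (norm (\<phi> x) powr p) \<partial>M)"
    by (intro nn_integral_scale_measure) measurable
  also have "\<dots> < \<infinity>"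
    using int by (simp add: ennreal_mult_less_top integrable_iff_bounded)
  also have "(\<integral>\<^sup>+x. ennreal (norm (\<phi> x) powr p) \<partial>?\<nu>)
      = (\<integral>\<^sup>+x. ennreal (norm (\<phi> (f x) * w x) powr p) \<partial>M)"
    by (simp add: nn_integral_distr nn_integral_density norm_mult powr_mult
        flip: ennreal_mult) (simp add: mult.commute)
  finally show ?thesis
    by (simp add: Lp_fun_def integrable_iff_bounded)
qed

lemma wcomp_op_class:
  fixes w :: "'a \<Rightarrow> 'k::{real_normed_field, second_countable_topology}"
  assumes wf: "weighted_composition p M w f" and \<phi>: "\<phi> \<in> Lp_fun p M"
  shows "wcomp_op p M w f (Lp_eq p M `` {\<phi>}) = Lp_eq p M `` {\<lambda>x. \<phi> (f x) * w x}"
proof -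
  from wf obtain c where [measurable]: "w \<in> borel_measurable M" "f \<in> measurable M M"
    and le: "\<And>B. B \<in> sets M \<Longrightarrow>
      (\<integral>\<^sup>+x\<in>B. ennreal (norm (w x) powr p) \<partial>M) \<le> ennreal c * emeasure M (f ` B)"
    by (auto simp: weighted_composition_def)
  have key: "AE x in M. \<phi> (f x) * w x = \<phi>' (f x) * w x"
    if ae: "AE x in M. \<phi> x = \<phi>' x" for \<phi>'
  proof -
    from AE_E[OF ae] obtain N where N: "{x \<in> space M. \<phi> x \<noteq> \<phi>' x} \<subseteq> N"
      "emeasure M N = 0" "N \<in> sets M" .
    have pre: "f -` N \<inter> space M \<in> sets M" using N(3) by measurable
    have "(\<integral>\<^sup>+x\<in>f -` N \<inter> space M. ennreal (norm (w x) powr p) \<partial>M)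
        \<le> ennreal c * emeasure M (f ` (f -` N \<inter> space M))"
      by (rule le[OF pre])
    also have "\<dots> \<le> ennreal c * emeasure M N"
      using N(3) by (intro mult_left_mono emeasure_mono) auto
    finally have "(\<integral>\<^sup>+x\<in>f -` N \<inter> space M. ennreal (norm (w x) powr p) \<partial>M) = 0"
      using N(2) by simp
    then have "AE x in M. ennreal (norm (w x) powr p) * indicator (f -` N \<inter> space M) x = 0"
      using pre by (subst (asm) nn_integral_0_iff_AE) auto
    then show ?thesis
      using AE_space
    proof eventually_elim
      case (elim x)
      then have "f x \<in> space M" by (auto dest: measurable_space[OF \<open>f \<in> measurable M M\<close>])
      with elim N(1) show ?case by (cases "f x \<in> N") auto
    qed
  qed
  show ?thesis
  proof (intro set_eqI iffI)
    fix \<psi> assume "\<psi> \<in> wcomp_op p M w f (Lp_eq p M `` {\<phi>})"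
    then obtain \<phi>' where *: "\<psi> \<in> Lp_fun p M" "AE x in M. \<phi> x = \<phi>' x"
        "AE x in M. \<psi> x = \<phi>' (f x) * w x"
      by (auto simp: wcomp_op_def Lp_eq_def)
    have "AE x in M. \<phi> (f x) * w x = \<psi> x"
      using key[OF *(2)] *(3) by eventually_elim simp
    then show "\<psi> \<in> Lp_eq p M `` {\<lambda>x. \<phi> (f x) * w x}"
      using * wcomp_Lp[OF assms] by (auto simp: Lp_eq_def)
  next
    fix \<psi> assume "\<psi> \<in> Lp_eq p M `` {\<lambda>x. \<phi> (f x) * w x}"
    then have "\<psi> \<in> Lp_fun p M" "AE x in M. \<psi> x = \<phi> (f x) * w x"
      by (auto simp: Lp_eq_def elim: AE_mp)
    then show "\<psi> \<in> wcomp_op p M w f (Lp_eq p M `` {\<phi>})"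
      using \<phi> by (auto simp: wcomp_op_def Lp_eq_def intro!: bexI[of _ \<phi>])
  qed
qed

end

theory Submission
  imports Defs
begin

text \<open>
  The map \<open>g = |\<phi>|\<^sup>p\<close> turns the orbit of \<open>\<phi>\<close> into the orbit of a nonnegative integrable function
  under the positive operator \<open>U g = |w|\<^sup>p \<cdot> (g \<circ> f)\<close>, and \<open>S n g = \<integral> U\<^sup>n g\<close> is the \<open>p\<close>-th power of
  the norm at time \<open>n\<close>. Since \<open>S n\<close> is additive and monotone, superposition of nonnegative
  functions never causes cancellation.

  If the operator is distributionally chaotic, let \<open>g = |\<phi> - \<psi>|\<^sup>p\<close> for a scrambled pair. Some iterate
  \<open>U\<^sup>m g\<close> has tiny integral, while \<open>S n (U\<^sup>m g)\<close> stays above a fixed bound on a set of upper density 1.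
  The level sets of simple functions approximating all the iterates from below form the family.

  Conversely, (b) provides normalised combinations \<open>g\<close> of indicators with \<open>S n g\<close> large on a fraction
  \<open>\<epsilon>\<close> of \<open>{1..N}\<close>. This fraction can be raised to any value below 1, replacing \<open>g\<close> by a multiple of
  some \<open>U\<^sup>m g\<close>: otherwise, in every window starting at a time with \<open>S m g \<le> t\<close>, the times with
  \<open>S n g > K t\<close> would make up at most a fraction \<open>1 - \<eta>\<close> of those with \<open>S n g > t\<close>, and iterating
  over \<open>t = 1, K, K\<^sup>2, \<dots>\<close> would push the fraction below \<open>\<epsilon>\<close>. A rapidly decreasing superposition of
  such functions yields \<open>u\<close> with \<open>S n u\<close> tending to 0 along one set of upper density 1 and to infinity
  along another, and the real multiples of \<open>u\<^sup>1\<^sup>/\<^sup>p\<close> form a scrambled set.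
\<close>

subsection \<open>Densities\<close>

lemma upper_dens_le_1: "upper_dens D \<le> 1"
  unfolding upper_dens_def
proof (rule Limsup_bounded, rule eventuallyI)
  fix n
  have "card (D \<inter> {1..n}) \<le> n"
    using card_mono[of "{1..n}" "D \<inter> {1..n}"] by simp
  then show "ereal (real (card (D \<inter> {1..n})) / real n) \<le> 1"
    by (cases "n = 0") (simp_all add: divide_le_eq_1)
qed

text \<open>Since an upper density never exceeds 1, only values below 1 have to be excluded, and a
  real number strictly between the density and 1 does that. The form without division suits counting
  arguments.\<close>

lemma upper_dens_eq_1_iff:
  "upper_dens D = 1 \<longleftrightarrow>
     (\<forall>\<eta>>0. \<forall>N0. \<exists>N\<ge>N0. real (card (D \<inter> {1..N})) > (1 - \<eta>) * real N)"
proof (intro iffI allI impI)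
  fix \<eta> :: real and N0 :: nat
  assume dens: "upper_dens D = 1" and "\<eta> > 0"
  show "\<exists>N\<ge>N0. real (card (D \<inter> {1..N})) > (1 - \<eta>) * real N"
  proof (rule ccontr)
    assume *: "\<not> ?thesis"
    have "\<forall>\<^sub>F n in sequentially. ereal (real (card (D \<inter> {1..n})) / real n) \<le> ereal (1 - \<eta>)"
      using eventually_ge_at_top[of "max 1 N0"]
    proof eventually_elim
      case (elim n)
      then have "real (card (D \<inter> {1..n})) \<le> (1 - \<eta>) * real n"
        using * by (auto simp: not_less)
      with elim show ?case by (simp add: divide_le_eq)
    qed
    then have "upper_dens D \<le> ereal (1 - \<eta>)"
      unfolding upper_dens_def by (rule Limsup_bounded)
    with dens \<open>\<eta> > 0\<close> show False by (simp add: one_ereal_def)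
  qed
next
  assume *: "\<forall>\<eta>>0. \<forall>N0. \<exists>N\<ge>N0. real (card (D \<inter> {1..N})) > (1 - \<eta>) * real N"
  have "\<not> upper_dens D < 1"
  proof
    assume "upper_dens D < 1"
    then obtain r where r: "upper_dens D < ereal r" "r < 1"
      using ereal_dense2[of "upper_dens D" 1] by (auto simp: one_ereal_def)
    from r(1) have "\<forall>\<^sub>F n in sequentially. ereal (real (card (D \<inter> {1..n})) / real n) < ereal r"
      unfolding upper_dens_def by (rule Limsup_lessD)
    then obtain N0 where N0: "\<And>n. n \<ge> N0 \<Longrightarrow> real (card (D \<inter> {1..n})) / real n < r"
      by (auto simp: eventually_sequentially)
    obtain N where N: "N \<ge> N0" "real (card (D \<inter> {1..N})) > (1 - (1 - r)) * real N"
      using * r(2) by (metis diff_gt_0_iff_gt)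
    then have "N > 0" by (cases N) auto
    with N0[OF N(1)] N(2) show False by (simp add: divide_less_eq)
  qed
  then show "upper_dens D = 1"
    using upper_dens_le_1[of D] by simp
qed

text \<open>The counts of \<open>D\<close> and of its complement in \<open>{1..n}\<close> add up to
  \<open>n\<close>. This turns the lower-density half of distributional chaos into a statement about
  upper density.\<close>

lemma lower_dens_eq_0_iff: "lower_dens D = 0 \<longleftrightarrow> upper_dens (- D) = 1"
proof -
  let ?a = "\<lambda>n. ereal (real (card (- D \<inter> {1..n})) / real n)"
  have "\<forall>\<^sub>F n in sequentially. ereal (real (card (D \<inter> {1..n})) / real n) = 1 - ?a n"
    using eventually_ge_at_top[of 1]
  proof eventually_elim
    case (elim n)
    have "card ((D \<inter> {1..n}) \<union> (- D \<inter> {1..n})) = card (D \<inter> {1..n}) + card (- D \<inter> {1..n})"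
      by (rule card_Un_disjoint) auto
    also have "(D \<inter> {1..n}) \<union> (- D \<inter> {1..n}) = {1..n}" by auto
    finally have "real n = real (card (D \<inter> {1..n})) + real (card (- D \<inter> {1..n}))" by simp
    with elim show ?case by (simp add: one_ereal_def field_simps)
  qed
  then have "lower_dens D = liminf (\<lambda>n. 1 - ?a n)"
    unfolding lower_dens_def by (rule Liminf_eq)
  also have "\<dots> = 1 - upper_dens (- D)"
    unfolding upper_dens_def by (rule liminf_ereal_cminus) simp
  finally have eq: "lower_dens D = 1 - upper_dens (- D)" .
  have "upper_dens (- D) \<ge> 0"
    unfolding upper_dens_def by (rule le_Limsup) (auto intro: always_eventually)
  with upper_dens_le_1[of "- D"] eq show ?thesis
    by (cases "upper_dens (- D)") (auto simp: one_ereal_def zero_ereal_def)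
qed

text \<open>The shift loses at most \<open>m\<close> elements of \<open>E\<close>, a share of at
  most \<open>\<eta> / 2\<close> once the window has length at least
  \<open>2 * m / \<eta>\<close>.\<close>

lemma upper_dens_shift:
  assumes "upper_dens E = 1"
  shows "upper_dens {n. n + m \<in> E} = 1"
  unfolding upper_dens_eq_1_iff
proof (intro allI impI)
  fix \<eta> :: real and N0 :: nat assume \<eta>: "\<eta> > 0"
  define N1 where "N1 = max N0 (nat \<lceil>2 * real m / \<eta>\<rceil>)"
  obtain N where N: "N \<ge> N1" "real (card (E \<inter> {1..N})) > (1 - \<eta> / 2) * real N"
    using assms \<eta> unfolding upper_dens_eq_1_iff by (meson half_gt_zero)
  have "2 * real m / \<eta> \<le> real N"
    using N(1) by (simp add: N1_def nat_le_iff ceiling_le_iff)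
  then have m: "real m \<le> \<eta> / 2 * real N" using \<eta> by (simp add: field_simps)
  have "E \<inter> {1..N} \<subseteq> {1..m} \<union> (\<lambda>n. n + m) ` ({n. n + m \<in> E} \<inter> {1..N})"
  proof
    fix n assume n: "n \<in> E \<inter> {1..N}"
    show "n \<in> {1..m} \<union> (\<lambda>n. n + m) ` ({n. n + m \<in> E} \<inter> {1..N})"
      using n by (cases "n \<le> m") (auto intro!: image_eqI[of _ _ "n - m"])
  qed
  then have "card (E \<inter> {1..N}) \<le> card ({1..m} \<union> (\<lambda>n. n + m) ` ({n. n + m \<in> E} \<inter> {1..N}))"
    by (intro card_mono) auto
  also have "\<dots> \<le> card {1..m} + card ((\<lambda>n. n + m) ` ({n. n + m \<in> E} \<inter> {1..N}))"
    by (rule card_Un_le)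
  also have "card ((\<lambda>n. n + m) ` ({n. n + m \<in> E} \<inter> {1..N})) = card ({n. n + m \<in> E} \<inter> {1..N})"
    by (rule card_image) simp
  finally have "real (card (E \<inter> {1..N})) \<le> real m + real (card ({n. n + m \<in> E} \<inter> {1..N}))"
    by simp
  with m N(2) have "real (card ({n. n + m \<in> E} \<inter> {1..N})) > (1 - \<eta>) * real N"
    by (simp add: algebra_simps)
  with N(1) show "\<exists>N\<ge>N0. real (card ({n. n + m \<in> E} \<inter> {1..N})) > (1 - \<eta>) * real N"
    by (intro exI[of _ N]) (simp add: N1_def)
qed

lemma strict_mono_choice:
  fixes P :: "nat \<Rightarrow> nat \<Rightarrow> bool"
  assumes "\<And>k N0. \<exists>N>N0. P k N"
  obtains N where "strict_mono N" "\<And>k. P k (N k)"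
proof -
  have "\<exists>N. \<forall>k. P k (N k) \<and> N k < N (Suc k)"
    using assms by (intro dependent_nat_choice) blast+
  then show thesis using that by (auto simp: strict_mono_Suc_iff)
qed

text \<open>Diagonal argument: the sets \<open>E k\<close>, on which \<open>s\<close> is below
  \<open>1 / (k + 1)\<close>, decrease in \<open>k\<close> and all have upper density 1. The set
  \<open>D\<close> obeys ever stricter conditions, each imposed only after the previous
  \<open>E k\<close> has nearly filled an initial segment.\<close>

lemma upper_dens_vanishing:
  fixes s :: "nat \<Rightarrow> ennreal"
  assumes "\<And>\<tau>::real. \<tau> > 0 \<Longrightarrow> upper_dens {n. s n < ennreal \<tau>} = 1"
  obtains D where "D \<subseteq> {1..}" "upper_dens D = 1" "(s \<longlongrightarrow> 0) (inf sequentially (principal D))"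
proof -
  define E where "E k = {n. s n < ennreal (1 / real (Suc k))}" for k
  have "\<exists>N>N0. real (card (E k \<inter> {1..N})) > (1 - 1 / real (Suc k)) * real N" for k N0
    using assms[of "1 / real (Suc k)"] unfolding upper_dens_eq_1_iff E_def
    by (metis Suc_le_eq of_nat_0_less_iff zero_less_Suc zero_less_divide_1_iff)
  then obtain N where N: "strict_mono N"
    "\<And>k. real (card (E k \<inter> {1..N k})) > (1 - 1 / real (Suc k)) * real (N k)"
    by (rule strict_mono_choice[where P = "\<lambda>k N. real (card (E k \<inter> {1..N})) > (1 - 1 / real (Suc k)) * real N"])
      (use that in blast)+
  have E_anti: "E k \<subseteq> E l" if "l \<le> k" for k l
  proof -
    have "1 / real (Suc k) \<le> 1 / real (Suc l)" using that by (simp add: field_simps)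
    then have "ennreal (1 / real (Suc k)) \<le> ennreal (1 / real (Suc l))" by (rule ennreal_leI)
    then show ?thesis unfolding E_def by (auto elim: order.strict_trans2)
  qed
  \<comment> \<open>Beyond \<open>N k\<close> the condition is \<open>E (Suc k)\<close>. A time up
    to \<open>N k\<close> thus meets only conditions of index at most \<open>k\<close>, all of which
    follow from membership in \<open>E k\<close>.\<close>
  define D where "D = {n. n \<ge> 1 \<and> (\<forall>k. N k < n \<longrightarrow> n \<in> E (Suc k))}"
  have sub: "E k \<inter> {1..N k} \<subseteq> D" for k
  proof
    fix n assume n: "n \<in> E k \<inter> {1..N k}"
    have "n \<in> E (Suc l)" if "N l < n" for l
    proof -
      have "N l < N k" using that n by simp
      then have "Suc l \<le> k" using N(1) by (simp add: strict_mono_less)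
      with E_anti n show ?thesis by blast
    qed
    with n show "n \<in> D" by (simp add: D_def)
  qed
  have "upper_dens D = 1"
    unfolding upper_dens_eq_1_iff
  proof (intro allI impI)
    fix \<eta> :: real and N0 :: nat assume \<eta>: "\<eta> > 0"
    obtain k0 where k0: "1 / real (Suc k0) < \<eta>"
      using \<eta> reals_Archimedean by (metis inverse_eq_divide)
    define k where "k = max k0 N0"
    have "1 / real (Suc k) \<le> 1 / real (Suc k0)" by (simp add: k_def field_simps)
    then have "(1 - \<eta>) * real (N k) \<le> (1 - 1 / real (Suc k)) * real (N k)"
      using k0 by (intro mult_right_mono) auto
    also have "\<dots> < real (card (E k \<inter> {1..N k}))" by (rule N(2))
    also have "\<dots> \<le> real (card (D \<inter> {1..N k}))"
      using sub[of k] by (auto intro!: card_mono)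
    finally have "real (card (D \<inter> {1..N k})) > (1 - \<eta>) * real (N k)" .
    moreover have "N0 \<le> N k"
      using strict_mono_imp_increasing[OF N(1), of k] by (simp add: k_def)
    ultimately show "\<exists>N\<ge>N0. real (card (D \<inter> {1..N})) > (1 - \<eta>) * real N" by blast
  qed
  moreover have "(s \<longlongrightarrow> 0) (inf sequentially (principal D))"
  proof (rule order_tendstoI)
    fix a :: ennreal assume "0 < a"
    then obtain \<tau> where \<tau>: "0 < \<tau>" "ennreal \<tau> < a"
      using dense[of 0 a] by (metis ennreal_cases ennreal_less_zero_iff less_top_ennreal linorder_not_less top_greatest)
    obtain k where k: "1 / real (Suc k) < \<tau>"
      using \<tau>(1) reals_Archimedean by (metis inverse_eq_divide)
    have "s n < a" if "n > N k" "n \<in> D" for n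
    proof -
      have "n \<in> E k" using that E_anti[of k "Suc k"] by (auto simp: D_def)
      then have "s n < ennreal (1 / real (Suc k))" by (simp add: E_def)
      also have "\<dots> \<le> ennreal \<tau>" using k by (intro ennreal_leI) simp
      finally show ?thesis using \<tau>(2) by simp
    qed
    then show "\<forall>\<^sub>F n in inf sequentially (principal D). s n < a"
      unfolding eventually_inf_principal
      by (intro eventually_mono[OF eventually_gt_at_top[of "N k"]]) blast
  qed simp
  moreover have "D \<subseteq> {1..}" by (auto simp: D_def)
  ultimately show thesis using that by blast
qed

lemma upper_dens_eventually:
  assumes "upper_dens D = 1" "eventually P (inf sequentially (principal D))"
  shows "upper_dens {n. P n} = 1"
proof -
  from assms(2) obtain m where m: "\<And>n. n \<ge> m \<Longrightarrow> n \<in> D \<Longrightarrow> P n"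
    by (auto simp: eventually_inf_principal eventually_sequentially)
  show ?thesis
    unfolding upper_dens_eq_1_iff
  proof (intro allI impI)
    fix \<eta> :: real and N0 :: nat assume \<eta>: "\<eta> > 0"
    define N1 where "N1 = max N0 (nat \<lceil>2 * real m / \<eta>\<rceil>)"
    obtain N where N: "N \<ge> N1" "real (card (D \<inter> {1..N})) > (1 - \<eta> / 2) * real N"
      using assms(1) \<eta> unfolding upper_dens_eq_1_iff by (meson half_gt_zero)
    have "2 * real m / \<eta> \<le> real N"
      using N(1) by (simp add: N1_def nat_le_iff ceiling_le_iff)
    then have *: "real m \<le> \<eta> / 2 * real N" using \<eta> by (simp add: field_simps)
    have "D \<inter> {1..N} \<subseteq> {1..m} \<union> {n. P n} \<inter> {1..N}"
      using m by (auto simp: not_le)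
    then have "card (D \<inter> {1..N}) \<le> card ({1..m} \<union> {n. P n} \<inter> {1..N})"
      by (intro card_mono) auto
    also have "\<dots> \<le> card {1..m} + card ({n. P n} \<inter> {1..N})"
      by (rule card_Un_le)
    finally have "real (card (D \<inter> {1..N})) \<le> real m + real (card ({n. P n} \<inter> {1..N}))"
      by simp
    with * N(2) have "real (card ({n. P n} \<inter> {1..N})) > (1 - \<eta>) * real N"
      by (simp add: algebra_simps)
    with N(1) show "\<exists>N\<ge>N0. real (card ({n. P n} \<inter> {1..N})) > (1 - \<eta>) * real N"
      by (intro exI[of _ N]) (simp add: N1_def)
  qed
qed

lemma upper_dens_mono_1:
  assumes "upper_dens D = 1" "D \<inter> {1..} \<subseteq> E"
  shows "upper_dens E = 1"
proof -
  have "eventually (\<lambda>n. n \<in> E) (inf sequentially (principal D))"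
    unfolding eventually_inf_principal
    using eventually_ge_at_top[of 1] by eventually_elim (use assms(2) in auto)
  from upper_dens_eventually[OF assms(1) this] show ?thesis by simp
qed

lemma less_divide_ennreal:
  fixes a b c :: ennreal
  shows "b \<noteq> 0 \<Longrightarrow> b < top \<Longrightarrow> a < c / b \<longleftrightarrow> a * b < c"
  by (cases a; cases b; cases c)
     (auto simp: divide_ennreal ennreal_mult[symmetric] ennreal_less_iff field_simps ennreal_top_mult ennreal_top_divide)

subsection \<open>Excursions of sequences of bounded growth\<close>

text \<open>A window is cut at the times where \<open>s \<le> t\<close>. Pieces of length at least \<open>N0\<close> obey the window
  bound; on shorter ones the growth rate keeps \<open>s\<close> below \<open>K * t\<close>.\<close>

lemma excursion_step:
  fixes s :: "nat \<Rightarrow> ennreal" and c K t :: ennreal and \<eta> :: real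
  assumes growth: "\<And>n j. s (n + j) \<le> c ^ j * s n" and c: "1 \<le> c"
    and K: "c ^ N0 \<le> K" and \<eta>: "\<eta> \<le> 1"
    and window: "\<And>m N. s m \<le> t \<Longrightarrow> N0 \<le> N \<Longrightarrow>
      real (card {n \<in> {m<..m + N}. K * t < s n}) \<le> (1 - \<eta>) * real N"
  shows "s m \<le> t \<Longrightarrow> real (card {n \<in> {m<..m + N}. K * t < s n})
    \<le> (1 - \<eta>) * real (card {n \<in> {m<..m + N}. t < s n})"
proof (induction N arbitrary: m rule: less_induct)
  case (less N)
  show ?case
  proof (cases "\<exists>k\<in>{m<..m + N}. s k \<le> t")
    case True
    then obtain k where k: "m < k" "k \<le> m + N" "s k \<le> t" by auto
    have t_le: "t \<le> K * t"
    proof -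
      have "1 * t \<le> K * t"
        using c K by (intro mult_right_mono) (auto intro: order_trans one_le_power)
      then show ?thesis by simp
    qed
    \<comment> \<open>The cut point \<open>k\<close> is counted on neither side of the inequality
      because \<open>s k \<le> t\<close>. So the left piece ends at \<open>k - 1\<close>, and the
      right piece starts at a time where the induction hypothesis applies again.\<close>
    have windows: "{m<..m + N} = {m<..m + (k - Suc m)} \<union> {k} \<union> {k<..k + (m + N - k)}"
      using k by auto
    have split: "card {n \<in> {m<..m + N}. a < s n} =
        card {n \<in> {m<..m + (k - Suc m)}. a < s n} + card {n \<in> {k<..k + (m + N - k)}. a < s n}"
      if "t \<le> a" for a
    proof -
      have "{n \<in> {m<..m + N}. a < s n} =
          {n \<in> {m<..m + (k - Suc m)}. a < s n} \<union> {n \<in> {k<..k + (m + N - k)}. a < s n}"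
        unfolding windows using k(3) that by auto
      moreover have "{n \<in> {m<..m + (k - Suc m)}. a < s n} \<inter> {n \<in> {k<..k + (m + N - k)}. a < s n} = {}"
        using k by auto
      ultimately show ?thesis by (simp add: card_Un_disjoint)
    qed
    show ?thesis
      unfolding split[OF t_le] split[OF order_refl] of_nat_add distrib_left
      by (intro add_mono less.IH) (use less.prems k in auto)
  next
    case False
    then have "{n \<in> {m<..m + N}. t < s n} = {m<..m + N}" by (auto simp: not_le)
    then have R: "real (card {n \<in> {m<..m + N}. t < s n}) = real N" by simp
    show ?thesis
    proof (cases "N0 \<le> N")
      case True
      then show ?thesis unfolding R using window less.prems by blast
    next
      case False
      have "s n \<le> K * t" if "n \<in> {m<..m + N}" for n
      proof -
        have "s n \<le> c ^ (n - m) * s m" using growth[of m "n - m"] that by simp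
        also have "\<dots> \<le> c ^ N0 * t"
          using less.prems that False c by (intro mult_mono power_increasing) auto
        also have "\<dots> \<le> K * t" using K by (intro mult_right_mono) auto
        finally show ?thesis .
      qed
      then have "{n \<in> {m<..m + N}. K * t < s n} = {}" by (blast dest: leD)
      then show ?thesis using \<eta> by (simp only: card.empty of_nat_0) simp
    qed
  qed
qed

text \<open>As \<open>K\<close> is at least 1, \<open>s 0\<close> lies below every level
  \<open>K ^ q\<close>, so the same window starting at time 0 is admissible at all levels. Each rise
  of the level by a factor \<open>K\<close> costs a factor \<open>1 - \<eta>\<close>.\<close>

lemma excursion_iterate:
  fixes s :: "nat \<Rightarrow> ennreal" and c K :: ennreal and \<eta> :: real
  assumes growth: "\<And>n j. s (n + j) \<le> c ^ j * s n" and c: "1 \<le> c"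
    and K: "c ^ N0 \<le> K" and \<eta>: "\<eta> \<le> 1" and s0: "s 0 \<le> 1"
    and window: "\<And>m N q. s m \<le> K ^ q \<Longrightarrow> N0 \<le> N \<Longrightarrow>
      real (card {n \<in> {m<..m + N}. K * K ^ q < s n}) \<le> (1 - \<eta>) * real N"
  shows "real (card {n \<in> {1..N}. K ^ q < s n}) \<le> (1 - \<eta>) ^ q * real N"
proof (induction q)
  case 0
  have "card {n \<in> {1..N}. 1 < s n} \<le> card {1..N}" by (rule card_mono) auto
  then show ?case by simp
next
  case (Suc q)
  have "1 \<le> K ^ q"
    using c K by (intro one_le_power) (auto intro: order_trans one_le_power)
  then have "s 0 \<le> K ^ q" using s0 by simp
  from excursion_step[OF growth c K \<eta> window this, of N]
  have "real (card {n \<in> {1..N}. K ^ Suc q < s n}) \<le> (1 - \<eta>) * real (card {n \<in> {1..N}. K ^ q < s n})"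
    by (simp add: atLeastSucAtMost_greaterThanAtMost)
  also have "\<dots> \<le> (1 - \<eta>) * ((1 - \<eta>) ^ q * real N)"
    using Suc \<eta> by (intro mult_left_mono) auto
  finally show ?case by (simp add: mult.assoc)
qed

subsection \<open>The induced operator on nonnegative functions\<close>

locale weighted_composition_op =
  fixes p :: real and M :: "'a measure"
    and w :: "'a \<Rightarrow> 'k::{real_normed_field, second_countable_topology}" and f :: "'a \<Rightarrow> 'a"
  assumes p: "1 \<le> p" and wc: "weighted_composition p M w f"
begin

lemma w_measurable [measurable]: "w \<in> borel_measurable M"
  and f_measurable [measurable]: "f \<in> measurable M M"
  using wc by (auto simp: weighted_composition_def)

text \<open>On \<open>g = |\<phi>|\<^sup>p\<close> the operator \<open>U\<close> is \<open>C\<^bsub>w,f\<^esub>\<close> and \<open>S n g\<close> is the \<open>p\<close>-th power of the norm of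
  \<open>C\<^bsub>w,f\<^esub>\<^sup>n \<phi>\<close>. Unlike the norm, \<open>S n\<close> is additive.\<close>

definition U :: "('a \<Rightarrow> ennreal) \<Rightarrow> 'a \<Rightarrow> ennreal" where
  "U g x = ennreal (norm (w x) powr p) * g (f x)"

definition S :: "nat \<Rightarrow> ('a \<Rightarrow> ennreal) \<Rightarrow> ennreal" where
  "S n g = (\<integral>\<^sup>+x. (U ^^ n) g x \<partial>M)"

lemma U_power:
  "(U ^^ n) g x = ennreal (norm (weight_iter w f n x) powr p) * g ((f ^^ n) x)"
proof (induction n arbitrary: x)
  case 0
  show ?case by (simp add: weight_iter_def)
next
  case (Suc n)
  \<comment> \<open>Peeling off the factor of index 0 matches the outermost \<open>U\<close>, which
    evaluates the remaining iterate at \<open>f x\<close>.\<close>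
  have "weight_iter w f (Suc n) x = w x * weight_iter w f n (f x)"
    by (simp add: weight_iter_def prod.lessThan_Suc_shift funpow_swap1 del: prod.lessThan_Suc)
  moreover have "(U ^^ Suc n) g x = ennreal (norm (w x) powr p) * (U ^^ n) g (f x)"
    by (simp add: U_def)
  ultimately show ?case
    unfolding Suc by (simp add: norm_mult powr_mult ennreal_mult mult.assoc funpow_swap1[of f])
qed

lemma U_power_measurable [measurable]:
  "g \<in> borel_measurable M \<Longrightarrow> (U ^^ n) g \<in> borel_measurable M"
proof (induction n)
  case (Suc n)
  then have [measurable]: "(U ^^ n) g \<in> borel_measurable M" by simp
  have "(U ^^ Suc n) g = (\<lambda>x. ennreal (norm (w x) powr p) * (U ^^ n) g (f x))"
    by (simp add: fun_eq_iff U_def)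
  then show ?case by simp
qed simp

lemma S_0: "S 0 g = (\<integral>\<^sup>+x. g x \<partial>M)"
  by (simp add: S_def)

lemma S_eq: "S n g = (\<integral>\<^sup>+x. ennreal (norm (weight_iter w f n x) powr p) * g ((f ^^ n) x) \<partial>M)"
  unfolding S_def by (rule nn_integral_cong) (rule U_power)

lemma weight_iter_measurable [measurable]: "weight_iter w f n \<in> borel_measurable M"
  unfolding weight_iter_def[abs_def] by measurable

lemma S_power: "S n ((U ^^ m) g) = S (m + n) g"
  by (simp add: S_def add.commute[of m n] funpow_add)

lemma S_cong:
  assumes "\<And>x. x \<in> space M \<Longrightarrow> g x = h x"
  shows "S n g = S n h"
  unfolding S_eq
  using assms measurable_space[OF measurable_compose_n[OF f_measurable, of n]]
  by (intro nn_integral_cong) simp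

lemma S_mono: "(\<And>x. x \<in> space M \<Longrightarrow> g x \<le> h x) \<Longrightarrow> S n g \<le> S n h"
  unfolding S_eq
  using measurable_space[OF measurable_compose_n[OF f_measurable, of n]]
  by (intro nn_integral_mono mult_left_mono) auto

lemma S_cmult: "g \<in> borel_measurable M \<Longrightarrow> S n (\<lambda>x. a * g x) = a * S n g"
  unfolding S_eq by (subst nn_integral_cmult[symmetric]) (simp_all add: mult.left_commute)

lemma S_add:
  assumes [measurable]: "g \<in> borel_measurable M" "h \<in> borel_measurable M"
  shows "S n (\<lambda>x. g x + h x) = S n g + S n h"
  unfolding S_eq by (subst nn_integral_add[symmetric]) (simp_all add: distrib_left)

lemma S_sum:
  assumes "\<And>i. i \<in> A \<Longrightarrow> g i \<in> borel_measurable M"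
  shows "S n (\<lambda>x. \<Sum>i\<in>A. g i x) = (\<Sum>i\<in>A. S n (g i))"
  unfolding S_eq using assms
  by (subst nn_integral_sum[symmetric]) (simp_all add: sum_distrib_left)

lemma S_SUP:
  assumes "\<And>i. g i \<in> borel_measurable M" "incseq g"
  shows "S n (\<lambda>x. SUP i. g i x) = (SUP i. S n (g i))"
proof -
  have "incseq (\<lambda>i. (U ^^ n) (g i))"
    using assms(2) by (auto simp: incseq_def le_fun_def U_power intro!: mult_left_mono)
  then have "(\<integral>\<^sup>+x. (SUP i. (U ^^ n) (g i) x) \<partial>M) = (SUP i. S n (g i))"
    unfolding S_def using assms(1) by (intro nn_integral_monotone_convergence_SUP) auto
  then show ?thesis by (simp add: S_def U_power SUP_mult_left_ennreal)
qed

text \<open>The indicator of the preimage is the indicator of \<open>B\<close> composed with the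
  iterate of \<open>f\<close>. Through this, conditions (a) and (b) become statements about
  \<open>S\<close>.\<close>

lemma mu_iter_preimage:
  assumes "B \<in> sets M"
  shows "mu_iter p M w f n (preimage_iter M f n B) = S n (indicator B)"
  unfolding mu_iter_def S_def preimage_iter_def
  by (intro nn_integral_cong) (auto simp: U_power indicator_def)

text \<open>The measure with density \<open>|w|^p\<close>, pushed forward by \<open>f\<close>, is at
  most \<open>c\<close> times \<open>M\<close>, because the image of a preimage of \<open>A\<close>
  lies in \<open>A\<close>. Integrating \<open>g\<close> bounds one step; the rest is
  iteration.\<close>

lemma S_growth:
  obtains C :: real where "1 \<le> C"
    "\<And>g n j. g \<in> borel_measurable M \<Longrightarrow> S (n + j) g \<le> ennreal C ^ j * S n g"
proof -
  obtain c where c: "c > 0" and le: "\<And>B. B \<in> sets M \<Longrightarrow>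
      (\<integral>\<^sup>+x\<in>B. ennreal (norm (w x) powr p) \<partial>M) \<le> ennreal c * emeasure M (f ` B)"
    using wc unfolding weighted_composition_def by blast
  let ?\<nu> = "distr (density M (\<lambda>x. ennreal (norm (w x) powr p))) M f"
  have \<nu>: "?\<nu> \<le> scale_measure (ennreal c) M"
  proof (subst le_measure)
    show "\<forall>A\<in>sets ?\<nu>. emeasure ?\<nu> A \<le> emeasure (scale_measure (ennreal c) M) A"
    proof
      fix A assume "A \<in> sets ?\<nu>"
      then have A [measurable]: "A \<in> sets M" by simp
      have pre: "f -` A \<inter> space M \<in> sets M" by measurable
      have "emeasure ?\<nu> A = (\<integral>\<^sup>+x\<in>f -` A \<inter> space M. ennreal (norm (w x) powr p) \<partial>M)"
        using pre by (simp add: emeasure_distr emeasure_density)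
      also have "\<dots> \<le> ennreal c * emeasure M (f ` (f -` A \<inter> space M))"
        by (rule le[OF pre])
      also have "\<dots> \<le> ennreal c * emeasure M A"
        by (intro mult_left_mono emeasure_mono) auto
      finally show "emeasure ?\<nu> A \<le> emeasure (scale_measure (ennreal c) M) A" by simp
    qed
  qed simp
  \<comment> \<open>The maximum with 1 makes the powers of \<open>C\<close> increasing, so that
    growth over fewer steps is bounded by growth over more.\<close>
  define C where "C = max 1 c"
  have one: "S 1 g \<le> ennreal C * S 0 g" if [measurable]: "g \<in> borel_measurable M" for g
  proof -
    have "S 1 g = (\<integral>\<^sup>+x. g x \<partial>?\<nu>)"
      by (simp add: S_eq weight_iter_def nn_integral_distr nn_integral_density)
    also have "\<dots> \<le> (\<integral>\<^sup>+x. g x \<partial>scale_measure (ennreal c) M)"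
      using \<nu> by (intro nn_integral_mono_measure) auto
    also have "\<dots> = ennreal c * S 0 g"
      by (simp add: S_0 nn_integral_scale_measure)
    also have "\<dots> \<le> ennreal C * S 0 g"
      by (intro mult_right_mono ennreal_leI) (auto simp: C_def)
    finally show ?thesis .
  qed
  have "S (n + j) g \<le> ennreal C ^ j * S n g" if [measurable]: "g \<in> borel_measurable M" for g n j
  proof (induction j)
    case (Suc j)
    have "S (n + Suc j) g \<le> ennreal C * S (n + j) g"
      using one[of "(U ^^ (n + j)) g"] by (simp add: S_power)
    also have "\<dots> \<le> ennreal C * (ennreal C ^ j * S n g)"
      using Suc by (intro mult_left_mono) auto
    finally show ?case by (simp add: mult.assoc)
  qed simp
  moreover have "1 \<le> C" by (simp add: C_def)
  ultimately show thesis by (rule that[rotated])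
qed

lemma S_null:
  assumes "g \<in> borel_measurable M" "S 0 g = 0"
  shows "S n g = 0"
proof -
  obtain C where "1 \<le> C" and C: "\<And>g n j. g \<in> borel_measurable M \<Longrightarrow> S (n + j) g \<le> ennreal C ^ j * S n g"
    by (rule S_growth) blast
  show ?thesis using C[OF assms(1), of 0 n] assms(2) by simp
qed

lemma S_finite:
  assumes [measurable]: "g \<in> borel_measurable M" and fin: "(\<integral>\<^sup>+x. g x \<partial>M) < \<infinity>"
  shows "S n g < \<infinity>"
proof -
  obtain C where "1 \<le> C" and C: "\<And>g n j. g \<in> borel_measurable M \<Longrightarrow> S (n + j) g \<le> ennreal C ^ j * S n g"
    by (rule S_growth) blast
  have "S (0 + n) g \<le> ennreal C ^ n * S 0 g" by (rule C) simp
  also have "\<dots> < \<infinity>"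
    using fin by (simp add: S_0 ennreal_mult_less_top power_less_top_ennreal)
  finally show ?thesis by simp
qed

text \<open>With \<open>D\<close> fixed, these functions form a convex cone that contains every
  measurable nonnegative minorant of its members and is invariant under \<open>U\<close>. All
  constructions stay inside it and so share the one set \<open>D\<close> of condition (a).\<close>

definition vanishing :: "nat set \<Rightarrow> ('a \<Rightarrow> ennreal) set" where
  "vanishing D = {g \<in> borel_measurable M. (\<integral>\<^sup>+x. g x \<partial>M) < \<infinity> \<and>
     ((\<lambda>n. S n g) \<longlongrightarrow> 0) (inf sequentially (principal D))}"

lemma vanishing_0: "(\<lambda>x. 0) \<in> vanishing D"
  using S_cmult[of "\<lambda>_. 0" _ 0] by (simp add: vanishing_def)

lemma vanishing_add:
  assumes "g \<in> vanishing D" "h \<in> vanishing D"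
  shows "(\<lambda>x. g x + h x) \<in> vanishing D"
proof -
  have "((\<lambda>n. S n g + S n h) \<longlongrightarrow> 0 + 0) (inf sequentially (principal D))"
    using assms by (intro tendsto_add) (auto simp: vanishing_def)
  with assms show ?thesis by (auto simp: vanishing_def S_add nn_integral_add)
qed

lemma vanishing_cmult:
  assumes "g \<in> vanishing D" "a < \<infinity>"
  shows "(\<lambda>x. a * g x) \<in> vanishing D"
proof -
  have "((\<lambda>n. a * S n g) \<longlongrightarrow> a * 0) (inf sequentially (principal D))"
    using assms by (intro ennreal_tendsto_cmult) (auto simp: vanishing_def)
  with assms show ?thesis
    by (auto simp: vanishing_def S_cmult nn_integral_cmult ennreal_mult_less_top)
qed

lemma vanishing_sum:
  assumes "finite A" "\<And>i. i \<in> A \<Longrightarrow> g i \<in> vanishing D"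
  shows "(\<lambda>x. \<Sum>i\<in>A. g i x) \<in> vanishing D"
  using assms by (induction A) (auto intro: vanishing_add vanishing_0)

lemma vanishing_mono:
  assumes g: "g \<in> vanishing D" and h: "h \<in> borel_measurable M"
    and le: "\<And>x. x \<in> space M \<Longrightarrow> h x \<le> g x"
  shows "h \<in> vanishing D"
proof -
  have "((\<lambda>n. S n h) \<longlongrightarrow> 0) (inf sequentially (principal D))"
  proof (rule tendsto_sandwich[OF _ _ tendsto_const])
    show "((\<lambda>n. S n g) \<longlongrightarrow> 0) (inf sequentially (principal D))"
      using g by (simp add: vanishing_def)
    show "\<forall>\<^sub>F n in inf sequentially (principal D). S n h \<le> S n g"
      by (intro always_eventually allI S_mono le)
  qed simp
  moreover have "(\<integral>\<^sup>+x. h x \<partial>M) < \<infinity>"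
    using g nn_integral_mono[of M h g, OF le] by (auto simp: vanishing_def)
  ultimately show ?thesis using h by (simp add: vanishing_def)
qed

text \<open>The value \<open>S (m + n) g\<close> is compared with \<open>S n g\<close> at the
  unshifted time \<open>n\<close>, at the cost of the constant \<open>C ^ m\<close>. Hence
  \<open>D\<close> need not be shifted.\<close>

lemma vanishing_power:
  assumes "g \<in> vanishing D"
  shows "(U ^^ m) g \<in> vanishing D"
proof -
  have [measurable]: "g \<in> borel_measurable M" and fin: "(\<integral>\<^sup>+x. g x \<partial>M) < \<infinity>"
    and lim: "((\<lambda>n. S n g) \<longlongrightarrow> 0) (inf sequentially (principal D))"
    using assms by (auto simp: vanishing_def)
  obtain C where "1 \<le> C" and C: "\<And>g n j. g \<in> borel_measurable M \<Longrightarrow> S (n + j) g \<le> ennreal C ^ j * S n g"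
    by (rule S_growth) blast
  have "((\<lambda>n. ennreal C ^ m * S n g) \<longlongrightarrow> ennreal C ^ m * 0) (inf sequentially (principal D))"
    using lim by (intro ennreal_tendsto_cmult) (simp_all add: power_less_top_ennreal)
  then have "((\<lambda>n. ennreal C ^ m * S n g) \<longlongrightarrow> 0) (inf sequentially (principal D))" by simp
  then have "((\<lambda>n. S n ((U ^^ m) g)) \<longlongrightarrow> 0) (inf sequentially (principal D))"
  proof (rule tendsto_sandwich[OF _ _ tendsto_const, rotated 2])
    show "\<forall>\<^sub>F n in inf sequentially (principal D). S n ((U ^^ m) g) \<le> ennreal C ^ m * S n g"
      unfolding S_power add.commute[of m] by (intro always_eventually allI C) simp
  qed simp
  moreover have "S 0 ((U ^^ m) g) < \<infinity>"
    using S_finite[of g m] fin by (simp add: S_power)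
  ultimately show ?thesis by (simp add: vanishing_def S_0)
qed

subsection \<open>Construction of an irregular function\<close>

text \<open>If the claim fails, no vanishing \<open>h\<close> with \<open>S 0 h \<le> 1\<close>
  exceeds \<open>K\<close> on most of a window of length at least \<open>N0\<close>. Applied to all
  normalised iterates of a single \<open>g\<close>, this is the window hypothesis of
  \<open>excursion_iterate\<close>, whose conclusion contradicts \<open>large\<close>.\<close>

lemma amplification:
  fixes K :: real
  assumes \<epsilon>: "0 < \<epsilon>" and \<eta>: "0 < \<eta>" "\<eta> \<le> 1"
    and large: "\<And>k::nat. \<exists>g\<in>vanishing D. S 0 g \<le> 1 \<and>
      (\<exists>N\<ge>1. real (card {n \<in> {1..N}. of_nat k < S n g}) \<ge> \<epsilon> * real N)"
  shows "\<exists>g\<in>vanishing D. S 0 g \<le> 1 \<and>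
      (\<exists>N\<ge>N0. real (card {n \<in> {1..N}. ennreal K < S n g}) > (1 - \<eta>) * real N)"
proof (rule ccontr)
  assume contra: "\<not> ?thesis"
  obtain C where C1: "1 \<le> C"
    and C: "\<And>g n j. g \<in> borel_measurable M \<Longrightarrow> S (n + j) g \<le> ennreal C ^ j * S n g"
    by (rule S_growth) blast
  \<comment> \<open>The part \<open>K\<close> lets excess over \<open>L\<close> imply excess over
    \<open>K\<close>; the part \<open>C ^ N0\<close> is the growth bound for windows shorter than
    \<open>N0\<close>.\<close>
  define L where "L = max K (C ^ N0)"
  have L1: "1 \<le> L" using C1 by (simp add: L_def le_max_iff_disj)
  \<comment> \<open>After \<open>q\<close> levels the share of large times is below
    \<open>\<epsilon>\<close>, while \<open>k\<close> above \<open>L ^ q\<close> keeps it at least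
    \<open>\<epsilon>\<close>.\<close>
  obtain q where q: "(1 - \<eta>) ^ q < \<epsilon>"
    using real_arch_pow_inv[of \<epsilon> "1 - \<eta>"] \<epsilon> \<eta> by auto
  obtain k :: nat where k: "L ^ q \<le> real k" using real_arch_simple by blast
  from large[of k] obtain g N where g: "g \<in> vanishing D" "S 0 g \<le> 1" and N: "N \<ge> 1"
    "real (card {n \<in> {1..N}. of_nat k < S n g}) \<ge> \<epsilon> * real N" by blast
  have gm [measurable]: "g \<in> borel_measurable M" using g by (simp add: vanishing_def)
  have window: "real (card {n \<in> {m<..m + N'}. ennreal L * ennreal L ^ r < S n g}) \<le> (1 - \<eta>) * real N'"
    if "S m g \<le> ennreal L ^ r" "N0 \<le> N'" for m N' r
  proof -
    define t where "t = ennreal L ^ r"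
    have t: "t \<noteq> 0" "t < \<infinity>" using L1 by (auto simp: t_def ennreal_power)
    \<comment> \<open>Dividing the iterate by the level \<open>t\<close> gives
      \<open>S 0 h \<le> 1\<close>, so the assumed failure applies to \<open>h\<close>; time
      \<open>n\<close> for \<open>g\<close> is time \<open>n - m\<close> for
      \<open>h\<close>.\<close>
    define h where "h = (\<lambda>x. inverse t * (U ^^ m) g x)"
    have h: "h \<in> vanishing D"
      unfolding h_def using g t
      by (intro vanishing_cmult vanishing_power) (auto simp: less_top[symmetric])
    have Sh: "S n h = S (m + n) g / t" for n
      by (simp add: h_def S_cmult S_power divide_ennreal_def mult.commute)
    have "S 0 h \<le> t / t" using that(1) unfolding Sh t_def by (intro divide_right_mono_ennreal) simp
    then have "S 0 h \<le> 1" using t by (simp add: ennreal_divide_self)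
    with contra h that(2)
    have "real (card {n \<in> {1..N'}. ennreal K < S n h}) \<le> (1 - \<eta>) * real N'" by (auto simp: not_less)
    moreover have "card {n \<in> {m<..m + N'}. ennreal L * ennreal L ^ r < S n g}
        \<le> card {n \<in> {1..N'}. ennreal K < S n h}"
    proof (rule card_inj_on_le)
      show "inj_on (\<lambda>n. n - m) {n \<in> {m<..m + N'}. ennreal L * ennreal L ^ r < S n g}"
        by (auto simp: inj_on_def)
      show "(\<lambda>n. n - m) ` {n \<in> {m<..m + N'}. ennreal L * ennreal L ^ r < S n g}
          \<subseteq> {n \<in> {1..N'}. ennreal K < S n h}"
      proof clarify
        fix n assume n: "n \<in> {m<..m + N'}" "ennreal L * ennreal L ^ r < S n g"
        have "ennreal L < S n g / t"
          using n(2) t by (simp add: less_divide_ennreal t_def)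
        moreover have "ennreal K \<le> ennreal L" by (intro ennreal_leI) (simp add: L_def)
        ultimately show "n - m \<in> {1..N'} \<and> ennreal K < S (n - m) h"
          using n(1) by (auto simp: Sh)
      qed
    qed simp
    ultimately show ?thesis by linarith
  qed
  have "real (card {n \<in> {1..N}. ennreal L ^ q < S n g}) \<le> (1 - \<eta>) ^ q * real N"
  proof -
    have "ennreal C ^ N0 \<le> ennreal L"
      using C1 by (simp add: ennreal_power L_def ennreal_leI)
    then show ?thesis
      by (intro excursion_iterate[of "\<lambda>n. S n g" "ennreal C" N0 "ennreal L" \<eta> N q])
        (use C[OF gm] C1 g(2) \<eta>(2) window in auto)
  qed
  also have "\<dots> < \<epsilon> * real N" using q N(1) by simp
  also have "\<dots> \<le> real (card {n \<in> {1..N}. of_nat k < S n g})" by (rule N(2))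
  also have "\<dots> \<le> real (card {n \<in> {1..N}. ennreal L ^ q < S n g})"
  proof -
    have "ennreal L ^ q \<le> of_nat k"
      using k L1 by (simp add: ennreal_power ennreal_of_nat_eq_real_of_nat ennreal_leI)
    then have "{n \<in> {1..N}. of_nat k < S n g} \<subseteq> {n \<in> {1..N}. ennreal L ^ q < S n g}" by auto
    then show ?thesis by (auto intro!: card_mono)
  qed
  finally show False by simp
qed

text \<open>A small multiple of an amplified function is added to \<open>v\<close>. It hardly
  changes the orbit up to time \<open>m\<close>, yet forces large values on most of some later
  window; the sum still vanishes along \<open>D\<close>, which supplies the new checkpoint
  \<open>m'\<close>.\<close>

lemma irregular_step:
  assumes D: "upper_dens D = 1" and \<epsilon>: "0 < \<epsilon>"
    and large: "\<And>k::nat. \<exists>g\<in>vanishing D. S 0 g \<le> 1 \<and>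
      (\<exists>N\<ge>1. real (card {n \<in> {1..N}. of_nat k < S n g}) \<ge> \<epsilon> * real N)"
    and v: "v \<in> vanishing D"
  shows "\<exists>v'\<in>vanishing D. v \<le> v' \<and> (\<forall>n\<le>m. S n v' \<le> S n v + ennreal ((1/2) ^ k)) \<and>
    (\<exists>N\<ge>k. real (card ({n. ennreal (real k) < S n v'} \<inter> {1..N})) > (1 - 1 / real (Suc k)) * real N) \<and>
    (\<exists>m'\<ge>max m k. real (card ({n. S n v' < ennreal (1 / real (Suc k))} \<inter> {1..m'}))
       > (1 - 1 / real (Suc k)) * real m')"
proof -
  obtain C where C1: "1 \<le> C"
    and C: "\<And>g n j. g \<in> borel_measurable M \<Longrightarrow> S (n + j) g \<le> ennreal C ^ j * S n g"
    by (rule S_growth) blast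
  \<comment> \<open>Up to time \<open>m\<close> the orbit of \<open>h\<close> is at most
    \<open>C ^ m\<close>, so adding \<open>\<delta>\<close> times \<open>h\<close> changes these
    values by at most \<open>(1/2) ^ k\<close>. The threshold for \<open>h\<close> is then
    \<open>k / \<delta>\<close>, so that the added part exceeds \<open>k\<close>.\<close>
  define \<delta> where "\<delta> = (1/2) ^ k / C ^ m"
  have \<delta>: "0 < \<delta>" using C1 by (simp add: \<delta>_def)
  obtain h N where h: "h \<in> vanishing D" "S 0 h \<le> 1" and N: "N \<ge> k"
    "real (card {n \<in> {1..N}. ennreal (real k / \<delta>) < S n h}) > (1 - 1 / real (Suc k)) * real N"
    using amplification[OF \<epsilon> _ _ large, of "1 / real (Suc k)" k "real k / \<delta>"] by auto
  have hm [measurable]: "h \<in> borel_measurable M" and vm [measurable]: "v \<in> borel_measurable M"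
    using h v by (auto simp: vanishing_def)
  define v' where "v' = (\<lambda>x. v x + ennreal \<delta> * h x)"
  have v': "v' \<in> vanishing D"
    unfolding v'_def using v h by (intro vanishing_add vanishing_cmult) auto
  have Sv': "S n v' = S n v + ennreal \<delta> * S n h" for n
    unfolding v'_def by (simp add: S_add S_cmult)
  have "S n v' \<le> S n v + ennreal ((1/2) ^ k)" if "n \<le> m" for n
  proof -
    have "S n h \<le> ennreal C ^ n * S 0 h" using C[OF hm, of 0 n] by simp
    also have "\<dots> \<le> ennreal C ^ m * 1"
      using that h(2) C1 by (intro mult_mono power_increasing) auto
    finally have "ennreal \<delta> * S n h \<le> ennreal \<delta> * ennreal (C ^ m)"
      using C1 by (intro mult_left_mono) (auto simp: ennreal_power)
    also have "\<dots> = ennreal ((1/2) ^ k)"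
      using C1 \<delta> by (simp add: \<delta>_def flip: ennreal_mult)
    finally show ?thesis unfolding Sv' by (intro add_left_mono)
  qed
  moreover have "real (card ({n. ennreal (real k) < S n v'} \<inter> {1..N})) > (1 - 1 / real (Suc k)) * real N"
  proof -
    have "ennreal (real k) < S n v'" if "ennreal (real k / \<delta>) < S n h" for n
    proof -
      have "ennreal (real k) = ennreal \<delta> * ennreal (real k / \<delta>)"
        using \<delta> by (simp flip: ennreal_mult)
      also have "\<dots> < ennreal \<delta> * S n h"
        using that \<delta> by (intro ennreal_mult_strict_left_mono) auto
      also have "\<dots> \<le> S n v'" unfolding Sv' by (simp add: add_increasing)
      finally show ?thesis .
    qed
    then have "card {n \<in> {1..N}. ennreal (real k / \<delta>) < S n h}
        \<le> card ({n. ennreal (real k) < S n v'} \<inter> {1..N})"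
      by (intro card_mono) auto
    with N(2) show ?thesis by linarith
  qed
  moreover have "\<exists>m'\<ge>max m k. real (card ({n. S n v' < ennreal (1 / real (Suc k))} \<inter> {1..m'}))
       > (1 - 1 / real (Suc k)) * real m'"
  proof -
    have "\<forall>\<^sub>F n in inf sequentially (principal D). S n v' < ennreal (1 / real (Suc k))"
      using v' by (intro order_tendstoD(2)[where y = 0]) (auto simp: vanishing_def)
    from upper_dens_eventually[OF D this] show ?thesis
      unfolding upper_dens_eq_1_iff by (metis of_nat_0_less_iff zero_less_Suc zero_less_divide_1_iff)
  qed
  moreover have "v \<le> v'" by (auto simp: le_fun_def v'_def)
  ultimately show ?thesis using v' N(1) by blast
qed

text \<open>The function \<open>u\<close> is the supremum of an increasing sequence built by
  \<open>irregular_step\<close>. Large values persist by monotonicity; small values observed before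
  a checkpoint persist because later additions there are summable.\<close>

lemma irregular_function:
  assumes D: "upper_dens D = 1" and \<epsilon>: "0 < \<epsilon>"
    and large: "\<And>k::nat. \<exists>g\<in>vanishing D. S 0 g \<le> 1 \<and>
      (\<exists>N\<ge>1. real (card {n \<in> {1..N}. of_nat k < S n g}) \<ge> \<epsilon> * real N)"
  obtains u where "u \<in> borel_measurable M" "S 0 u < \<infinity>"
    "\<And>\<tau>::real. 0 < \<tau> \<Longrightarrow> upper_dens {n. S n u < ennreal \<tau>} = 1"
    "\<And>K::real. upper_dens {n. ennreal K < S n u} = 1"
proof -
  \<comment> \<open>The state is a pair of the current function and the checkpoint up to which its
    orbit must be preserved; \<open>Q k\<close> is one step of the recursion.\<close>
  define Q where "Q k a b \<longleftrightarrow> fst a \<le> fst b \<and> snd a \<le> snd b \<and> k \<le> snd b \<and>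
    (\<forall>n\<le>snd a. S n (fst b) \<le> S n (fst a) + ennreal ((1/2) ^ k)) \<and>
    (\<exists>N\<ge>k. real (card ({n. ennreal (real k) < S n (fst b)} \<inter> {1..N})) > (1 - 1 / real (Suc k)) * real N) \<and>
    real (card ({n. S n (fst b) < ennreal (1 / real (Suc k))} \<inter> {1..snd b}))
       > (1 - 1 / real (Suc k)) * real (snd b)" for k :: nat and a b
  have "\<exists>F. \<forall>k. (fst (F k) \<in> vanishing D \<and> (k = 0 \<longrightarrow> F k = ((\<lambda>x. 0), 0))) \<and> Q k (F k) (F (Suc k))"
  proof (rule dependent_nat_choice)
    show "\<exists>x. fst x \<in> vanishing D \<and> ((0::nat) = 0 \<longrightarrow> x = ((\<lambda>x. 0), 0))"
      using vanishing_0 by auto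
    fix x :: "('a \<Rightarrow> ennreal) \<times> nat" and k :: nat
    assume "fst x \<in> vanishing D \<and> (k = 0 \<longrightarrow> x = ((\<lambda>x. 0), 0))"
    then have "fst x \<in> vanishing D" by simp
    from irregular_step[OF D \<epsilon> large this, of "snd x" k]
    obtain v' m' where "v' \<in> vanishing D" "Q k x (v', m')"
      unfolding Q_def by auto
    then show "\<exists>y. (fst y \<in> vanishing D \<and> (Suc k = 0 \<longrightarrow> y = ((\<lambda>x. 0), 0))) \<and> Q k x y"
      by (intro exI[of _ "(v', m')"]) simp
  qed
  then obtain F where F: "\<And>k. fst (F k) \<in> vanishing D" "F 0 = ((\<lambda>x. 0), 0)" "\<And>k. Q k (F k) (F (Suc k))"
    by blast
  define v m where "v k = fst (F k)" and "m k = snd (F k)" for k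
  have v: "v k \<in> vanishing D" "v 0 = (\<lambda>x. 0)" "v k \<le> v (Suc k)" "m k \<le> m (Suc k)" "k \<le> m (Suc k)" "m 0 = 0"
    and step: "n \<le> m k \<Longrightarrow> S n (v (Suc k)) \<le> S n (v k) + ennreal ((1/2) ^ k)"
    and big: "\<exists>N\<ge>k. real (card ({n. ennreal (real k) < S n (v (Suc k))} \<inter> {1..N})) > (1 - 1 / real (Suc k)) * real N"
    and small: "real (card ({n. S n (v (Suc k)) < ennreal (1 / real (Suc k))} \<inter> {1..m (Suc k)}))
       > (1 - 1 / real (Suc k)) * real (m (Suc k))" for k n
    using F(1)[of k] F(2) F(3)[of k] unfolding Q_def v_def m_def by auto
  have vm [measurable]: "v k \<in> borel_measurable M" for k
    using v(1) by (simp add: vanishing_def)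
  have inc: "incseq v" using v(3) by (rule incseq_SucI)
  have inc_m: "incseq m" using v(4) by (rule incseq_SucI)
  define u where "u = (\<lambda>x. SUP k. v k x)"
  have um: "u \<in> borel_measurable M" unfolding u_def by measurable
  have Su: "S n u = (SUP k. S n (v k))" for n
    unfolding u_def by (rule S_SUP[OF vm inc])
  have tail: "S n u \<le> S n (v j) + ennreal (2 * (1/2) ^ j)" if n: "n \<le> m j" for n j
  proof -
    \<comment> \<open>The summand \<open>2 * (1/2) ^ i\<close> is the sum of all increments still
      allowed from step \<open>i\<close> on, so this total cannot increase with
      \<open>i\<close>.\<close>
    have *: "S n (v i) + ennreal (2 * (1/2) ^ i) \<le> S n (v j) + ennreal (2 * (1/2) ^ j)" if "j \<le> i" for i
      using that
    proof (induction i rule: dec_induct)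
      case (step i)
      have "n \<le> m i" using n inc_m step(1) by (meson incseqD order_trans)
      then have "S n (v (Suc i)) + ennreal (2 * (1/2) ^ Suc i)
          \<le> (S n (v i) + ennreal ((1/2) ^ i)) + ennreal (2 * (1/2) ^ Suc i)"
        by (intro add_right_mono \<open>\<And>n k. n \<le> m k \<Longrightarrow> S n (v (Suc k)) \<le> S n (v k) + ennreal ((1/2) ^ k)\<close>)
      also have "\<dots> = S n (v i) + ennreal (2 * (1/2) ^ i)"
        by (simp add: add.assoc flip: ennreal_plus)
      finally show ?case using step.IH by simp
    qed simp
    have "S n (v i) \<le> S n (v j) + ennreal (2 * (1/2) ^ j)" for i
    proof -
      have "S n (v i) \<le> S n (v (max i j))"
        using inc by (intro S_mono) (auto simp: incseq_def le_fun_def)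
      also have "\<dots> \<le> S n (v (max i j)) + ennreal (2 * (1/2) ^ max i j)" by simp
      also have "\<dots> \<le> S n (v j) + ennreal (2 * (1/2) ^ j)" by (rule *) simp
      finally show ?thesis .
    qed
    then show ?thesis unfolding Su by (rule SUP_least)
  qed
  have "S 0 u \<le> S 0 (v 0) + ennreal (2 * (1/2) ^ 0)" by (rule tail) simp
  also have "\<dots> < \<infinity>" using v(1)[of 0] by (simp add: S_0 vanishing_def)
  finally have fin: "S 0 u < \<infinity>" .
  have "upper_dens {n. S n u < ennreal \<tau>} = 1" if \<tau>: "0 < \<tau>" for \<tau> :: real
    unfolding upper_dens_eq_1_iff
  proof (intro allI impI)
    fix \<eta> :: real and N0 :: nat assume \<eta>: "0 < \<eta>"
    \<comment> \<open>Half of \<open>\<tau>\<close> is reserved for the value at the checkpoint and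
      half for the tail of later additions; each will be at most \<open>1 / (k + 1)\<close>.\<close>
    obtain k0 where k0: "1 / real (Suc k0) < min (\<tau> / 2) \<eta>"
      using reals_Archimedean[of "min (\<tau> / 2) \<eta>"] \<tau> \<eta> by (auto simp: inverse_eq_divide)
    define k where "k = max k0 N0"
    have "1 / real (Suc k) \<le> 1 / real (Suc k0)" by (simp add: k_def field_simps)
    with k0 have k: "1 / real (Suc k) < \<tau> / 2" "1 / real (Suc k) < \<eta>" by auto
    have "real (Suc k) \<le> 2 ^ k"
      by (metis Suc_leI less_exp of_nat_le_iff of_nat_numeral of_nat_power)
    then have pow: "(1/2) ^ k \<le> 1 / real (Suc k)"
      by (simp add: power_one_over field_simps)
    have "S n u < ennreal \<tau>" if "n \<le> m (Suc k)" "S n (v (Suc k)) < ennreal (1 / real (Suc k))" for n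
    proof -
      have "S n u \<le> S n (v (Suc k)) + ennreal (2 * (1/2) ^ Suc k)" by (rule tail[OF that(1)])
      also have "\<dots> \<le> ennreal (1 / real (Suc k)) + ennreal (1 / real (Suc k))"
        using that(2) pow by (intro add_mono ennreal_leI) auto
      also have "\<dots> = ennreal (2 * (1 / real (Suc k)))" by (simp flip: ennreal_plus)
      also have "\<dots> < ennreal \<tau>" using k(1) \<tau> by (intro ennreal_lessI) auto
      finally show ?thesis .
    qed
    then have "card ({n. S n (v (Suc k)) < ennreal (1 / real (Suc k))} \<inter> {1..m (Suc k)})
        \<le> card ({n. S n u < ennreal \<tau>} \<inter> {1..m (Suc k)})"
      by (intro card_mono) auto
    moreover have "(1 - \<eta>) * real (m (Suc k)) \<le> (1 - 1 / real (Suc k)) * real (m (Suc k))"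
      using k(2) by (intro mult_right_mono) auto
    ultimately show "\<exists>N\<ge>N0. real (card ({n. S n u < ennreal \<tau>} \<inter> {1..N})) > (1 - \<eta>) * real N"
      using small[of k] v(5)[of k] by (intro exI[of _ "m (Suc k)"]) (auto simp: k_def)
  qed
  moreover have "upper_dens {n. ennreal K < S n u} = 1" for K :: real
    unfolding upper_dens_eq_1_iff
  proof (intro allI impI)
    fix \<eta> :: real and N0 :: nat assume \<eta>: "0 < \<eta>"
    obtain k0 where k0: "1 / real (Suc k0) < \<eta>"
      using reals_Archimedean[of \<eta>] \<eta> by (auto simp: inverse_eq_divide)
    obtain k1 :: nat where k1: "K \<le> real k1" using real_arch_simple by blast
    define k where "k = max (max k0 k1) N0"
    have "1 / real (Suc k) \<le> 1 / real (Suc k0)" by (simp add: k_def field_simps)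
    with k0 have k: "1 / real (Suc k) < \<eta>" by simp
    obtain N where N: "N \<ge> k"
      "real (card ({n. ennreal (real k) < S n (v (Suc k))} \<inter> {1..N})) > (1 - 1 / real (Suc k)) * real N"
      using big by blast
    have "ennreal K < S n u" if "ennreal (real k) < S n (v (Suc k))" for n
    proof -
      have "ennreal K \<le> ennreal (real k)" using k1 by (intro ennreal_leI) (simp add: k_def)
      also note that
      also have "S n (v (Suc k)) \<le> S n u" unfolding Su by (rule SUP_upper) simp
      finally show ?thesis .
    qed
    then have "card ({n. ennreal (real k) < S n (v (Suc k))} \<inter> {1..N}) \<le> card ({n. ennreal K < S n u} \<inter> {1..N})"
      by (intro card_mono) auto
    moreover have "(1 - \<eta>) * real N \<le> (1 - 1 / real (Suc k)) * real N"
      using k by (intro mult_right_mono) auto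
    ultimately show "\<exists>N\<ge>N0. real (card ({n. ennreal K < S n u} \<inter> {1..N})) > (1 - \<eta>) * real N"
      using N by (intro exI[of _ N]) (auto simp: k_def)
  qed
  ultimately show thesis using that[OF um fin] by simp
qed

end

subsection \<open>Orbits in the space of classes\<close>

text \<open>Finiteness of \<open>a\<close> matters, since \<open>enn2real\<close> sends infinity to
  0.\<close>

lemma powr_inverse_less_iff:
  fixes a :: ennreal and \<tau> p :: real
  assumes "0 < p" "0 < \<tau>" "a < \<infinity>"
  shows "enn2real a powr (1 / p) < \<tau> \<longleftrightarrow> a < ennreal (\<tau> powr p)"
proof -
  have "enn2real a powr (1 / p) < \<tau> \<longleftrightarrow> (enn2real a powr (1 / p)) powr p < \<tau> powr p"
    using assms by (smt (verit) powr_less_mono2 powr_mono2 powr_ge_zero)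
  also have "(enn2real a powr (1 / p)) powr p = enn2real a"
    using assms by (simp add: powr_powr)
  also have "enn2real a < \<tau> powr p \<longleftrightarrow> a < ennreal (\<tau> powr p)"
    using assms by (cases a) (auto simp: ennreal_less_iff)
  finally show ?thesis .
qed

text \<open>The norm of a difference is at most twice the larger norm, which gives the integrable
  majorant with factor \<open>2 powr p\<close>.\<close>

lemma Lp_fun_diff:
  fixes \<phi> \<psi> :: "'a \<Rightarrow> 'k::{real_normed_vector, second_countable_topology}"
  assumes p: "0 < p" and "\<phi> \<in> Lp_fun p M" "\<psi> \<in> Lp_fun p M"
  shows "(\<lambda>x. \<phi> x - \<psi> x) \<in> Lp_fun p M"
proof -
  have [measurable]: "\<phi> \<in> borel_measurable M" "\<psi> \<in> borel_measurable M"
    and int: "integrable M (\<lambda>x. norm (\<phi> x) powr p)" "integrable M (\<lambda>x. norm (\<psi> x) powr p)"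
    using assms by (auto simp: Lp_fun_def)
  have "integrable M (\<lambda>x. 2 powr p * (norm (\<phi> x) powr p + norm (\<psi> x) powr p))"
    using int by auto
  then have "integrable M (\<lambda>x. norm (\<phi> x - \<psi> x) powr p)"
  proof (rule Bochner_Integration.integrable_bound)
    have "norm (\<phi> x - \<psi> x) powr p \<le> 2 powr p * (norm (\<phi> x) powr p + norm (\<psi> x) powr p)" for x
    proof -
      have "norm (\<phi> x - \<psi> x) \<le> norm (\<phi> x) + norm (\<psi> x)" by (rule norm_triangle_ineq4)
      then have "norm (\<phi> x - \<psi> x) powr p \<le> (2 * max (norm (\<phi> x)) (norm (\<psi> x))) powr p"
        using p by (intro powr_mono2) auto
      also have "\<dots> = 2 powr p * max (norm (\<phi> x)) (norm (\<psi> x)) powr p"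
        by (simp add: powr_mult)
      also have "\<dots> \<le> 2 powr p * (norm (\<phi> x) powr p + norm (\<psi> x) powr p)"
        by (intro mult_left_mono) (auto simp: max_def)
      finally show ?thesis .
    qed
    then show "AE x in M. norm (norm (\<phi> x - \<psi> x) powr p)
        \<le> norm (2 powr p * (norm (\<phi> x) powr p + norm (\<psi> x) powr p))"
      by (intro AE_I2) simp
  qed measurable
  then show ?thesis by (simp add: Lp_fun_def)
qed

context weighted_composition_op begin

abbreviation cls :: "('a \<Rightarrow> 'k) \<Rightarrow> ('a \<Rightarrow> 'k) set" where
  "cls \<phi> \<equiv> Lp_eq p M `` {\<phi>}"

lemma wcomp_op_power:
  assumes "\<phi> \<in> Lp_fun p M"
  shows "(\<lambda>x. \<phi> ((f ^^ n) x) * weight_iter w f n x) \<in> Lp_fun p M \<and>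
    (wcomp_op p M w f ^^ n) (cls \<phi>) = cls (\<lambda>x. \<phi> ((f ^^ n) x) * weight_iter w f n x)"
proof (induction n)
  case 0
  show ?case using assms by (simp add: weight_iter_def)
next
  case (Suc n)
  let ?\<psi> = "\<lambda>x. \<phi> ((f ^^ n) x) * weight_iter w f n x"
  have "weight_iter w f (Suc n) x = weight_iter w f n (f x) * w x" for x
    by (simp add: weight_iter_def prod.lessThan_Suc_shift funpow_swap1 del: prod.lessThan_Suc)
  then have "(\<lambda>x. \<phi> ((f ^^ Suc n) x) * weight_iter w f (Suc n) x) = (\<lambda>x. ?\<psi> (f x) * w x)"
    by (simp add: fun_eq_iff funpow_swap1 mult.assoc)
  then show ?case
    using Suc wcomp_Lp[OF wc, of ?\<psi>] wcomp_op_class[OF wc, of ?\<psi>] by simp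
qed

lemma S_Lp_finite:
  assumes "\<phi> \<in> Lp_fun p M"
  shows "S n (\<lambda>x. ennreal (norm (\<phi> x) powr p)) < \<infinity>"
  using assms by (intro S_finite) (auto simp: Lp_fun_def integrable_iff_bounded)

text \<open>By linearity the difference of two orbits is the orbit of the difference, whose norm has
  \<open>S n\<close> as its \<open>p\<close>-th power. This passes between the metric on classes and
  \<open>S\<close>.\<close>

lemma Lp_dist_orbit_less_iff:
  assumes \<phi>: "\<phi> \<in> Lp_fun p M" and \<psi>: "\<psi> \<in> Lp_fun p M" and \<tau>: "0 < \<tau>"
  shows "Lp_dist p M ((wcomp_op p M w f ^^ n) (cls \<phi>)) ((wcomp_op p M w f ^^ n) (cls \<psi>)) < \<tau> \<longleftrightarrow>
    S n (\<lambda>x. ennreal (norm (\<phi> x - \<psi> x) powr p)) < ennreal (\<tau> powr p)"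
proof -
  have d: "(\<lambda>x. \<phi> x - \<psi> x) \<in> Lp_fun p M"
    using p \<phi> \<psi> by (intro Lp_fun_diff) auto
  then have dm [measurable]: "(\<lambda>x. \<phi> x - \<psi> x) \<in> borel_measurable M"
    by (simp add: Lp_fun_def)
  have "Lp_dist p M ((wcomp_op p M w f ^^ n) (cls \<phi>)) ((wcomp_op p M w f ^^ n) (cls \<psi>))
      = Lp_norm p M (\<lambda>x. (\<phi> ((f ^^ n) x) - \<psi> ((f ^^ n) x)) * weight_iter w f n x)"
    using wcomp_op_power[OF \<phi>, of n] wcomp_op_power[OF \<psi>, of n]
    by (simp add: Lp_dist_class left_diff_distrib)
  also have "\<dots> = enn2real (\<integral>\<^sup>+x. ennreal (norm ((\<phi> ((f ^^ n) x) - \<psi> ((f ^^ n) x)) * weight_iter w f n x) powr p) \<partial>M) powr (1 / p)"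
    unfolding Lp_norm_def
    using measurable_compose[OF measurable_compose_n[OF f_measurable, of n] dm]
    by (subst integral_eq_nn_integral) auto
  also have "(\<integral>\<^sup>+x. ennreal (norm ((\<phi> ((f ^^ n) x) - \<psi> ((f ^^ n) x)) * weight_iter w f n x) powr p) \<partial>M)
      = S n (\<lambda>x. ennreal (norm (\<phi> x - \<psi> x) powr p))"
    unfolding S_eq by (intro nn_integral_cong) (simp add: norm_mult powr_mult ennreal_mult mult.commute)
  finally show ?thesis
    using p \<tau> S_Lp_finite[OF d, of n] by (simp add: powr_inverse_less_iff)
qed

text \<open>For the real multiples \<open>a\<close> and \<open>b\<close> of the \<open>p\<close>-th
  root of \<open>u\<close>, the \<open>p\<close>-th power of the distance at time \<open>n\<close>
  is \<open>|a - b|^p\<close> times \<open>S n u\<close>. All pairs thus differ only by a rescaling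
  of thresholds, and \<open>small\<close> and \<open>big\<close> hold for every threshold.\<close>

lemma distributionally_chaotic_of_irregular:
  assumes um [measurable]: "u \<in> borel_measurable M" and fin: "S 0 u < \<infinity>"
    and small: "\<And>\<tau>::real. 0 < \<tau> \<Longrightarrow> upper_dens {n. S n u < ennreal \<tau>} = 1"
    and big: "\<And>K::real. upper_dens {n. ennreal K < S n u} = 1"
  shows "distributionally_chaotic (Lp_space p M) (Lp_dist p M) (wcomp_op p M w f)"
proof -
  define \<phi> :: "real \<Rightarrow> 'a \<Rightarrow> 'k" where
    "\<phi> a x = of_real (a * enn2real (u x) powr (1 / p))" for a x
  \<comment> \<open>Where \<open>u\<close> is infinite, \<open>enn2real\<close> returns 0. The part
    lost there is \<open>r\<close>, which lives on a null set and stays invisible to every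
    \<open>S n\<close>.\<close>
  define r where "r = (\<lambda>x. if u x = \<infinity> then \<infinity> else 0 :: ennreal)"
  have rm [measurable]: "r \<in> borel_measurable M" unfolding r_def by measurable
  have Sr: "S n r = 0" for n
  proof -
    have "AE x in M. u x \<noteq> \<infinity>"
      using fin by (intro nn_integral_PInf_AE) (auto simp: S_0)
    then have "AE x in M. r x = 0" by eventually_elim (simp add: r_def)
    then have "S 0 r = 0" unfolding S_0 by (subst nn_integral_0_iff_AE) auto
    then show ?thesis by (rule S_null[OF rm])
  qed
  have "u = (\<lambda>x. ennreal (enn2real (u x)) + r x)"
    by (auto simp: r_def fun_eq_iff ennreal_enn2real_if)
  then have "S n u = S n (\<lambda>x. ennreal (enn2real (u x)) + r x)" for n by simp
  then have Su: "S n (\<lambda>x. ennreal (enn2real (u x))) = S n u" for n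
    by (simp add: S_add Sr)
  have S\<phi>: "S n (\<lambda>x. ennreal (norm (\<phi> a x - \<phi> b x) powr p)) = ennreal (\<bar>a - b\<bar> powr p) * S n u" for a b n
  proof -
    have "norm (\<phi> a x - \<phi> b x) powr p = \<bar>a - b\<bar> powr p * enn2real (u x)" for x
    proof -
      have "norm (\<phi> a x - \<phi> b x) = \<bar>a - b\<bar> * enn2real (u x) powr (1 / p)"
        unfolding \<phi>_def of_real_diff[symmetric] norm_of_real left_diff_distrib[symmetric]
        by (simp add: abs_mult)
      then show ?thesis using p by (simp add: powr_mult powr_powr)
    qed
    then show ?thesis by (simp add: ennreal_mult S_cmult Su)
  qed
  have \<phi>m [measurable]: "\<phi> a \<in> borel_measurable M" for a unfolding \<phi>_def[abs_def] by measurable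
  have \<phi>_Lp: "\<phi> a \<in> Lp_fun p M" for a
  proof -
    have "\<phi> 0 = (\<lambda>x. 0)" by (simp add: \<phi>_def fun_eq_iff)
    then have "(\<integral>\<^sup>+x. ennreal (norm (\<phi> a x) powr p) \<partial>M) = ennreal (\<bar>a\<bar> powr p) * S 0 u"
      using S\<phi>[of 0 a 0] by (simp add: S_0)
    also have "\<dots> < \<infinity>" using fin by (simp add: ennreal_mult_less_top)
    finally show ?thesis by (simp add: Lp_fun_def integrable_iff_bounded)
  qed
  have less_iff: "Lp_dist p M ((wcomp_op p M w f ^^ n) (cls (\<phi> a))) ((wcomp_op p M w f ^^ n) (cls (\<phi> b))) < \<tau>
      \<longleftrightarrow> S n u < ennreal (\<tau> powr p / \<bar>a - b\<bar> powr p)" if "a \<noteq> b" "0 < \<tau>" for a b \<tau> n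
  proof -
    have "S n u < \<infinity>" using S_finite[OF um] fin by (simp add: S_0)
    with that show ?thesis
      unfolding Lp_dist_orbit_less_iff[OF \<phi>_Lp \<phi>_Lp that(2)] S\<phi>
      by (cases "S n u") (auto simp: ennreal_less_iff less_divide_eq mult.commute simp flip: ennreal_mult)
  qed
  have dens_small: "upper_dens {n. 1 \<le> n \<and> Lp_dist p M ((wcomp_op p M w f ^^ n) (cls (\<phi> a))) ((wcomp_op p M w f ^^ n) (cls (\<phi> b))) < \<tau>} = 1"
    if "a \<noteq> b" "0 < \<tau>" for a b \<tau>
    by (rule upper_dens_mono_1[OF small[of "\<tau> powr p / \<bar>a - b\<bar> powr p"]])
      (use that in \<open>auto simp: less_iff\<close>)
  have dens_big: "lower_dens {n. 1 \<le> n \<and> Lp_dist p M ((wcomp_op p M w f ^^ n) (cls (\<phi> a))) ((wcomp_op p M w f ^^ n) (cls (\<phi> b))) < 1} = 0"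
    if "a \<noteq> b" for a b
    unfolding lower_dens_eq_0_iff
    by (rule upper_dens_mono_1[OF big[of "1 / \<bar>a - b\<bar> powr p"]]) (auto simp: less_iff that)
  \<comment> \<open>If two parameters gave the same class, all distances would be 0 and all positive
    times would have lower density 0, which is absurd.\<close>
  have "inj (\<lambda>a. cls (\<phi> a))"
  proof (rule injI, rule ccontr)
    fix a b assume eq: "cls (\<phi> a) = cls (\<phi> b)" and ab: "a \<noteq> b"
    have "Lp_dist p M ((wcomp_op p M w f ^^ n) (cls (\<phi> b))) ((wcomp_op p M w f ^^ n) (cls (\<phi> b))) < 1" for n
      using Lp_dist_orbit_less_iff[OF \<phi>_Lp \<phi>_Lp, of 1 n b b] S\<phi>[of n b b] p by simp
    then have "lower_dens {n. 1 \<le> n} = 0" using dens_big[OF ab] by (simp add: eq)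
    then have "upper_dens {0} = 1"
      unfolding lower_dens_eq_0_iff by (rule upper_dens_mono_1) auto
    moreover have "upper_dens {0} = 0"
      by (simp add: upper_dens_def zero_ereal_def Limsup_const)
    ultimately show False by simp
  qed
  then have "uncountable (range (\<lambda>a. cls (\<phi> a)))"
    using uncountable_UNIV_real by (simp add: countable_image_inj_eq)
  moreover have "range (\<lambda>a. cls (\<phi> a)) \<subseteq> Lp_space p M"
    using \<phi>_Lp by (auto simp: Lp_space_def quotient_def)
  moreover have "lower_dens {n. 1 \<le> n \<and> Lp_dist p M ((wcomp_op p M w f ^^ n) x) ((wcomp_op p M w f ^^ n) y) < 1} = 0 \<and>
      (\<forall>\<tau>>0. upper_dens {n. 1 \<le> n \<and> Lp_dist p M ((wcomp_op p M w f ^^ n) x) ((wcomp_op p M w f ^^ n) y) < \<tau>} = 1)"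
    if "x \<in> range (\<lambda>a. cls (\<phi> a))" "y \<in> range (\<lambda>a. cls (\<phi> a))" "x \<noteq> y" for x y
  proof -
    from that obtain a b where "x = cls (\<phi> a)" "y = cls (\<phi> b)" "a \<noteq> b" by blast
    then show ?thesis using dens_small dens_big by blast
  qed
  ultimately show ?thesis
    unfolding distributionally_chaotic_def by (meson zero_less_one)
qed

subsection \<open>Level sets of a distributionally irregular orbit\<close>

text \<open>One scrambled pair suffices: \<open>g\<close> is the \<open>p\<close>-th power of the
  norm of the difference of two representatives, and \<open>\<delta>\<close> is
  \<open>\<epsilon> powr p\<close>.\<close>

lemma irregular_of_distributionally_chaotic:
  assumes "distributionally_chaotic (Lp_space p M) (Lp_dist p M) (wcomp_op p M w f)"
  obtains g and \<delta> :: real where "g \<in> borel_measurable M" "S 0 g < \<infinity>" "0 < \<delta>"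
    "upper_dens {n. ennreal \<delta> \<le> S n g} = 1"
    "\<And>\<tau>::real. 0 < \<tau> \<Longrightarrow> upper_dens {n. S n g < ennreal \<tau>} = 1"
proof -
  let ?d = "\<lambda>n x y. Lp_dist p M ((wcomp_op p M w f ^^ n) x) ((wcomp_op p M w f ^^ n) y)"
  from assms obtain \<Gamma> \<epsilon> where \<Gamma>: "\<Gamma> \<subseteq> Lp_space p M" "uncountable \<Gamma>" "0 < \<epsilon>"
    and chaos: "\<forall>x\<in>\<Gamma>. \<forall>y\<in>\<Gamma>. x \<noteq> y \<longrightarrow>
      lower_dens {n. 1 \<le> n \<and> ?d n x y < \<epsilon>} = 0 \<and>
      (\<forall>\<tau>>0. upper_dens {n. 1 \<le> n \<and> ?d n x y < \<tau>} = 1)"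
    unfolding distributionally_chaotic_def by blast
  have "\<exists>x\<in>\<Gamma>. \<exists>y\<in>\<Gamma>. x \<noteq> y"
  proof (rule ccontr)
    assume "\<not> ?thesis"
    then have "\<exists>x. \<Gamma> \<subseteq> {x}" by blast
    then show False using \<Gamma>(2) by (meson countable_empty countable_insert countable_subset)
  qed
  then obtain x y where xy: "x \<in> \<Gamma>" "y \<in> \<Gamma>" "x \<noteq> y" by blast
  have lower: "lower_dens {n. 1 \<le> n \<and> ?d n x y < \<epsilon>} = 0"
    and upper: "\<And>\<tau>. 0 < \<tau> \<Longrightarrow> upper_dens {n. 1 \<le> n \<and> ?d n x y < \<tau>} = 1"
    using chaos xy by blast+
  have "x \<in> Lp_space p M" "y \<in> Lp_space p M" using xy \<Gamma>(1) by auto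
  then obtain \<phi> \<psi> where \<phi>: "\<phi> \<in> Lp_fun p M" "x = cls \<phi>" and \<psi>: "\<psi> \<in> Lp_fun p M" "y = cls \<psi>"
    by (auto simp: Lp_space_def quotient_def)
  define g where "g = (\<lambda>x. ennreal (norm (\<phi> x - \<psi> x) powr p))"
  have less_iff: "?d n x y < \<tau> \<longleftrightarrow> S n g < ennreal (\<tau> powr p)" if "0 < \<tau>" for n \<tau>
    unfolding \<phi>(2) \<psi>(2) g_def by (rule Lp_dist_orbit_less_iff[OF \<phi>(1) \<psi>(1) that])
  have d: "(\<lambda>x. \<phi> x - \<psi> x) \<in> Lp_fun p M"
    using p \<phi> \<psi> by (intro Lp_fun_diff) auto
  show thesis
  proof (rule that)
    show "g \<in> borel_measurable M"
      using d unfolding g_def Lp_fun_def by (intro measurable_compose[OF _ measurable_ennreal]) auto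
    show "S 0 g < \<infinity>" unfolding g_def by (rule S_Lp_finite[OF d])
    show "0 < \<epsilon> powr p" using \<Gamma>(3) by simp
    show "upper_dens {n. ennreal (\<epsilon> powr p) \<le> S n g} = 1"
      by (rule upper_dens_mono_1[OF lower[unfolded lower_dens_eq_0_iff]])
        (auto simp: less_iff \<Gamma>(3) not_less)
    show "upper_dens {n. S n g < ennreal \<tau>} = 1" if "0 < \<tau>" for \<tau>
      by (rule upper_dens_mono_1[OF upper[of "\<tau> powr (1 / p)"]])
        (use that p in \<open>auto simp: less_iff powr_powr\<close>)
  qed
qed

text \<open>Null level sets are dropped because \<open>S n\<close> of their indicators is 0 for
  every \<open>n\<close>. The remaining ones have positive measure, as the family requires.\<close>

lemma S_simple_function:
  assumes F: "simple_function M F"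
  defines "A \<equiv> \<lambda>y. F -` {y} \<inter> space M"
  defines "Y \<equiv> {y \<in> F ` space M. y \<noteq> 0 \<and> emeasure M (A y) \<noteq> 0}"
  shows "S n F = (\<Sum>y\<in>Y. y * S n (indicator (A y)))"
proof -
  have A: "A y \<in> sets M" for y unfolding A_def by (rule simple_functionD(2)[OF F])
  then have Am [measurable]: "indicator (A y) \<in> borel_measurable M" for y by simp
  have "S n F = S n (\<lambda>x. \<Sum>y\<in>F ` space M. y * indicator (A y) x)"
    unfolding A_def by (intro S_cong simple_function_indicator_representation[OF F])
  also have "\<dots> = (\<Sum>y\<in>F ` space M. y * S n (indicator (A y)))"
    by (subst S_sum) (auto simp: S_cmult)
  also have "\<dots> = (\<Sum>y\<in>Y. y * S n (indicator (A y)))"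
  proof (rule sum.mono_neutral_right)
    show "finite (F ` space M)" by (rule simple_functionD(1)[OF F])
    show "\<forall>y\<in>F ` space M - Y. y * S n (indicator (A y)) = 0"
    proof
      fix y assume "y \<in> F ` space M - Y"
      then have "y = 0 \<or> emeasure M (A y) = 0" by (auto simp: Y_def)
      then show "y * S n (indicator (A y)) = 0"
        using S_null[OF Am, of y n] A by (auto simp: S_0)
    qed
  qed (auto simp: Y_def)
  finally show ?thesis .
qed

text \<open>For the simple functions \<open>F m i\<close> below \<open>U^m g\<close>, the quotient
  in (b) is \<open>S n (F m i) / S 0 (F m i)\<close>. The denominator is at most the tiny
  \<open>S m g\<close>, while for large \<open>i\<close> the numerator comes close to
  \<open>S (m + n) g\<close>, which is often at least \<open>\<delta>\<close>.\<close>

lemma level_set_family: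
  fixes \<delta> :: real
  assumes D: "upper_dens D = 1" and g: "g \<in> vanishing D" and \<delta>: "0 < \<delta>"
    and big: "upper_dens {n. ennreal \<delta> \<le> S n g} = 1"
  obtains \<B> where "countable \<B>"
    "\<And>A. A \<in> \<B> \<Longrightarrow> A \<in> sets M \<and> 0 < emeasure M A \<and> emeasure M A < \<infinity> \<and> indicator A \<in> vanishing D"
    "\<And>k N0 :: nat. \<exists>N>N0. \<exists>Y A. finite Y \<and> Y \<noteq> {} \<and> (\<forall>y\<in>Y. 0 < y \<and> y < \<infinity> \<and> A y \<in> \<B>) \<and>
      real (card {n \<in> {1..N}. of_nat k <
        (\<Sum>y\<in>Y. y * S n (indicator (A y))) / (\<Sum>y\<in>Y. y * emeasure M (A y))}) \<ge> 1 / 2 * real N"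
proof -
  have gm [measurable]: "g \<in> borel_measurable M" using g by (simp add: vanishing_def)
  define h where "h m = (U ^^ m) g" for m
  have hv: "h m \<in> vanishing D" for m unfolding h_def by (rule vanishing_power[OF g])
  have hm [measurable]: "h m \<in> borel_measurable M" for m using hv by (simp add: vanishing_def)
  have Sh: "S n (h m) = S (m + n) g" for m n by (simp add: h_def S_power)
  have "\<forall>m. \<exists>F. (\<forall>i. simple_function M (F i)) \<and> incseq F \<and> (\<forall>i x. F i x < top) \<and> (\<forall>x. (SUP i. F i x) = h m x)"
    using borel_measurable_implies_simple_function_sequence'[OF hm] by metis
  then obtain F where F: "\<And>m i. simple_function M (F m i)" "\<And>m. incseq (F m)"
    "\<And>m i x. F m i x < top" "\<And>m x. (SUP i. F m i x) = h m x"
    by metis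
  have Fle: "F m i x \<le> h m x" for m i x unfolding F(4)[symmetric] by (rule SUP_upper) simp
  define A where "A m i y = F m i -` {y} \<inter> space M" for m i y
  define Y where "Y m i = {y \<in> F m i ` space M. y \<noteq> 0 \<and> emeasure M (A m i y) \<noteq> 0}" for m i
  have finY: "finite (Y m i)" for m i
    using simple_functionD(1)[OF F(1)] by (simp add: Y_def)
  have Ym: "0 < y" "y < \<infinity>" if "y \<in> Y m i" for m i y
    using that F(3)[of m i] by (auto simp: Y_def zero_less_iff_neq_zero)
  have SF: "S n (F m i) = (\<Sum>y\<in>Y m i. y * S n (indicator (A m i y)))" for n m i
    unfolding Y_def A_def by (rule S_simple_function[OF F(1)])
  define \<B> where "\<B> = (\<Union>m. \<Union>i. A m i ` Y m i)"
  have "countable \<B>"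
    unfolding \<B>_def by (intro countable_UN countable_image) (simp_all add: countable_finite finY)
  moreover have "B \<in> sets M \<and> 0 < emeasure M B \<and> emeasure M B < \<infinity> \<and> indicator B \<in> vanishing D" if "B \<in> \<B>" for B
  proof -
    from that obtain m i y where y: "y \<in> Y m i" and B: "B = A m i y" by (auto simp: \<B>_def)
    have BM: "B \<in> sets M" unfolding B A_def by (rule simple_functionD(2)[OF F(1)])
    \<comment> \<open>On its level set \<open>F m i\<close> equals \<open>y\<close> and lies below
      \<open>h m\<close>, so the indicator is dominated by a finite multiple of \<open>h m\<close>.
      This yields vanishing along \<open>D\<close> and finite measure at once.\<close>
    have "(\<lambda>x. inverse y * h m x) \<in> vanishing D"
      using Ym[OF y] by (intro vanishing_cmult hv) (simp add: less_top[symmetric])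
    then have v: "indicator B \<in> vanishing D"
    proof (rule vanishing_mono)
      fix x
      show "indicator B x \<le> inverse y * h m x"
      proof (cases "x \<in> B")
        case True
        then have "inverse y * y \<le> inverse y * h m x"
          using Fle[of m i x] by (intro mult_left_mono) (auto simp: B A_def)
        moreover have "inverse y * y = 1"
          using Ym[OF y] ennreal_divide_self[of y] by (simp add: divide_ennreal_def mult.commute)
        ultimately show ?thesis using True by simp
      qed simp
    qed (use BM in simp)
    then have "emeasure M B < \<infinity>" using BM by (simp add: vanishing_def)
    moreover have "0 < emeasure M B" using y by (simp add: B Y_def zero_less_iff_neq_zero)
    ultimately show ?thesis using v BM by blast
  qed
  moreover have "\<exists>N>N0. \<exists>Y A. finite Y \<and> Y \<noteq> {} \<and> (\<forall>y\<in>Y. 0 < y \<and> y < \<infinity> \<and> A y \<in> \<B>) \<and>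
      real (card {n \<in> {1..N}. of_nat k <
        (\<Sum>y\<in>Y. y * S n (indicator (A y))) / (\<Sum>y\<in>Y. y * emeasure M (A y))}) \<ge> 1 / 2 * real N"
    for k N0 :: nat
  proof -
    have "\<forall>\<^sub>F n in inf sequentially (principal D). S n g < ennreal (\<delta> / real (Suc k))"
      using g \<delta> by (intro order_tendstoD(2)[where y = 0]) (auto simp: vanishing_def)
    \<comment> \<open>With \<open>\<eta> = 1\<close> the density criterion merely says that such a
      time exists.\<close>
    from upper_dens_eventually[OF D this, unfolded upper_dens_eq_1_iff, rule_format, of 1 0]
    obtain m where m: "S m g < ennreal (\<delta> / real (Suc k))"
      by (auto simp: card_gt_0_iff)
    \<comment> \<open>The strict inequality leaves room for approximating values that are at least
      \<open>\<delta>\<close> from below.\<close>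
    have k_lt: "of_nat k * S m g < ennreal \<delta>"
    proof -
      have "of_nat k * S m g \<le> ennreal (real k) * ennreal (\<delta> / real (Suc k))"
        using m by (intro mult_mono) (auto simp: ennreal_of_nat_eq_real_of_nat)
      also have "\<dots> = ennreal (real k * (\<delta> / real (Suc k)))"
        using \<delta> by (simp flip: ennreal_mult)
      also have "\<dots> < ennreal \<delta>" using \<delta> by (intro ennreal_lessI) (auto simp: field_simps)
      finally show ?thesis .
    qed
    obtain N where N: "N \<ge> Suc N0"
      "real (card ({n. n + m \<in> {n. ennreal \<delta> \<le> S n g}} \<inter> {1..N})) > (1 - 1 / 2) * real N"
      using upper_dens_shift[OF big, of m] unfolding upper_dens_eq_1_iff
      by (meson half_gt_zero zero_less_one)
    define X where "X = {n. n + m \<in> {n. ennreal \<delta> \<le> S n g}} \<inter> {1..N}"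
    have "\<forall>\<^sub>F i in sequentially. of_nat k * S m g < S n (F m i)" if "n \<in> X" for n
    proof -
      have "(\<lambda>i. S n (F m i)) \<longlonglongrightarrow> (SUP i. S n (F m i))"
        using F(2)[of m] by (intro LIMSEQ_SUP) (auto simp: incseq_def le_fun_def intro!: S_mono)
      also have "(SUP i. S n (F m i)) = S n (\<lambda>x. SUP i. F m i x)"
        by (rule S_SUP[symmetric, OF borel_measurable_simple_function[OF F(1)] F(2)])
      also have "\<dots> = S (n + m) g" unfolding F(4) by (simp add: Sh add.commute)
      finally show ?thesis
        by (rule order_tendstoD(1)) (use that k_lt in \<open>auto simp: X_def\<close>)
    qed
    \<comment> \<open>The convergence in \<open>i\<close> depends on \<open>n\<close>, but
      \<open>X\<close> is finite, so a single \<open>i\<close> serves all its times.\<close>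
    then have "\<forall>\<^sub>F i in sequentially. \<forall>n\<in>X. of_nat k * S m g < S n (F m i)"
      by (intro eventually_ball_finite) (auto simp: X_def)
    then obtain i where i: "\<And>n. n \<in> X \<Longrightarrow> of_nat k * S m g < S n (F m i)"
      by (auto simp: eventually_sequentially)
    define q where "q = (\<Sum>y\<in>Y m i. y * emeasure M (A m i y))"
    have q_eq: "q = S 0 (F m i)"
      unfolding q_def SF
      using simple_functionD(2)[OF F(1)] by (intro sum.cong) (simp_all add: S_0 A_def)
    have q_le: "q \<le> S m g"
      unfolding q_eq using S_mono[of "F m i" "h m" 0] Fle by (simp add: Sh)
    have "X \<noteq> {}" using N by (auto simp: X_def)
    then obtain n0 where "n0 \<in> X" by blast
    then have n0: "0 < S n0 (F m i)" using i[of n0] by (meson le_less_trans zero_le)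
    then have Yne: "Y m i \<noteq> {}" unfolding SF by (metis less_irrefl sum.empty)
    \<comment> \<open>If \<open>q\<close> were 0, then \<open>F m i\<close> would be null and its
      whole orbit would vanish, contrary to its positive value at \<open>n0\<close>.\<close>
    have q0: "q \<noteq> 0"
    proof -
      have "S n0 (F m i) \<noteq> 0" using n0 by simp
      then show ?thesis
        unfolding q_eq using S_null[OF borel_measurable_simple_function[OF F(1)]] by blast
    qed
    have qfin: "q < top"
      using q_le S_finite[OF gm, of m] g by (auto simp: vanishing_def intro: le_less_trans)
    have "X \<subseteq> {n \<in> {1..N}. of_nat k < (\<Sum>y\<in>Y m i. y * S n (indicator (A m i y))) / q}"
    proof
      fix n assume n: "n \<in> X"
      have "of_nat k * q \<le> of_nat k * S m g" using q_le by (intro mult_left_mono) auto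
      also have "\<dots> < S n (F m i)" by (rule i[OF n])
      finally have "of_nat k < S n (F m i) / q" using q0 qfin by (simp add: less_divide_ennreal)
      then show "n \<in> {n \<in> {1..N}. of_nat k < (\<Sum>y\<in>Y m i. y * S n (indicator (A m i y))) / q}"
        using n by (simp add: SF X_def)
    qed
    then have "card X \<le> card {n \<in> {1..N}. of_nat k < (\<Sum>y\<in>Y m i. y * S n (indicator (A m i y))) / q}"
      by (intro card_mono) auto
    with N(2) have "real (card {n \<in> {1..N}. of_nat k < (\<Sum>y\<in>Y m i. y * S n (indicator (A m i y))) / q}) \<ge> 1 / 2 * real N"
      by (simp add: X_def)
    moreover have "\<forall>y\<in>Y m i. 0 < y \<and> y < \<infinity> \<and> A m i y \<in> \<B>"
      using Ym unfolding \<B>_def by blast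
    ultimately show ?thesis
      using N(1) finY[of m i] Yne unfolding q_def
      by (intro exI[of _ N] conjI exI[of _ "Y m i"] exI[of _ "A m i"]) simp_all
  qed
  ultimately show thesis by (rule that)
qed

end

section \<open>The two implications of the equivalence\<close>

theorem theorem24:
  fixes M :: "'a measure"
    and f :: "'a \<Rightarrow> 'a"
    and w :: "'a \<Rightarrow> 'k::{real_normed_field, euclidean_space}"
    and p :: real
  assumes "1 \<le> p"
    and "weighted_composition p M w f"
  shows "distributionally_chaotic (Lp_space p M) (Lp_dist p M) (wcomp_op p M w f) \<longleftrightarrow>
    (\<exists>(I :: nat set) (B :: nat \<Rightarrow> 'a set).
       I \<noteq> {} \<and>
       (\<forall>i\<in>I. B i \<in> sets M \<and> 0 < emeasure M (B i) \<and> emeasure M (B i) < \<infinity>) \<and>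
       (\<exists>D. D \<subseteq> {1..} \<and> upper_dens D = 1 \<and>
          (\<forall>i\<in>I. ((\<lambda>n. mu_iter p M w f n (preimage_iter M f n (B i))) \<longlongrightarrow> 0)
             (inf sequentially (principal D)))) \<and>
       (\<exists>(\<epsilon>::real) (N :: nat \<Rightarrow> nat).
          \<epsilon> > 0 \<and> strict_mono_on {1..} N \<and> (\<forall>k\<ge>1. N k > 0) \<and>
          (\<forall>k\<ge>1. \<exists>(r::nat) (i :: nat \<Rightarrow> nat) (b :: nat \<Rightarrow> real).
             r \<ge> 1 \<and> (\<forall>j\<in>{1..r}. i j \<in> I \<and> b j > 0) \<and>
             real (card {n \<in> {1..N k}.
               (\<Sum>j=1..r. ennreal (b j) * mu_iter p M w f n (preimage_iter M f n (B (i j))))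
                 / (\<Sum>j=1..r. ennreal (b j) * emeasure M (B (i j))) > of_nat k})
             \<ge> \<epsilon> * real (N k))))"
    (is "_ \<longleftrightarrow> (\<exists>I B. I \<noteq> {} \<and> ?meas I B \<and> ?small I B \<and> ?large I B)")
proof -
  interpret weighted_composition_op p M w f
    by unfold_locales fact+
  show ?thesis
  proof
    assume "distributionally_chaotic (Lp_space p M) (Lp_dist p M) (wcomp_op p M w f)"
    then obtain g and \<delta> :: real where g: "g \<in> borel_measurable M" "S 0 g < \<infinity>" and \<delta>: "0 < \<delta>"
      and big: "upper_dens {n. ennreal \<delta> \<le> S n g} = 1"
      and vanish: "\<And>\<tau>::real. 0 < \<tau> \<Longrightarrow> upper_dens {n. S n g < ennreal \<tau>} = 1"
      by (rule irregular_of_distributionally_chaotic) blast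
    from vanish obtain D where D: "D \<subseteq> {1..}" "upper_dens D = 1"
      and lim: "((\<lambda>n. S n g) \<longlongrightarrow> 0) (inf sequentially (principal D))"
      by (rule upper_dens_vanishing) blast
    have "g \<in> vanishing D" using g lim by (simp add: vanishing_def S_0)
    from D(2) this \<delta> big obtain \<B> where \<B>: "countable \<B>"
      and \<B>_props: "\<And>A. A \<in> \<B> \<Longrightarrow> A \<in> sets M \<and> 0 < emeasure M A \<and> emeasure M A < \<infinity> \<and> indicator A \<in> vanishing D"
      and \<B>_large: "\<And>k N0 :: nat. \<exists>N>N0. \<exists>Y A. finite Y \<and> Y \<noteq> {} \<and> (\<forall>y\<in>Y. 0 < y \<and> y < \<infinity> \<and> A y \<in> \<B>) \<and>
        real (card {n \<in> {1..N}. of_nat k <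
          (\<Sum>y\<in>Y. y * S n (indicator (A y))) / (\<Sum>y\<in>Y. y * emeasure M (A y))}) \<ge> 1 / 2 * real N"
      by (rule level_set_family) blast
    define R where "R k N \<longleftrightarrow> (\<exists>Y A. finite Y \<and> Y \<noteq> {} \<and> (\<forall>y\<in>Y. 0 < y \<and> y < \<infinity> \<and> A y \<in> \<B>) \<and>
        real (card {n \<in> {1..N}. of_nat k <
          (\<Sum>y\<in>Y. y * S n (indicator (A y))) / (\<Sum>y\<in>Y. y * emeasure M (A y))}) \<ge> 1 / 2 * real N)"
      for k N :: nat
    have "\<exists>N>N0. R k N" for k N0
      unfolding R_def by (rule \<B>_large)
    then obtain N where N: "strict_mono N" and N_large: "\<And>k. R k (N k)"
      by (rule strict_mono_choice[where P = R]) blast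
    \<comment> \<open>The family is indexed by the codes of its members, which covers finite and
      infinite families alike.\<close>
    define I where "I = to_nat_on \<B> ` \<B>"
    define B where "B = from_nat_into \<B>"
    have BI: "B (to_nat_on \<B> A) = A" if "A \<in> \<B>" for A
      using \<B> that by (simp add: B_def)
    then have B_in: "B i \<in> \<B>" if "i \<in> I" for i
      using that by (auto simp: I_def)
    have "I \<noteq> {}" using N_large[of 0] by (auto simp: I_def R_def)
    moreover have "?meas I B" using B_in \<B>_props by blast
    moreover have "?small I B"
    proof (intro exI[of _ D] conjI ballI D)
      fix i assume "i \<in> I"
      from \<B>_props[OF B_in[OF this]]
      show "((\<lambda>n. mu_iter p M w f n (preimage_iter M f n (B i))) \<longlongrightarrow> 0) (inf sequentially (principal D))"
        by (simp add: mu_iter_preimage vanishing_def)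
    qed
    moreover have "?large I B"
    proof (intro exI[of _ "1 / 2 :: real"] exI[of _ N] conjI allI impI)
      show "strict_mono_on {1..} N" using N by (auto simp: strict_mono_on_def strict_mono_def)
      fix k :: nat assume "1 \<le> k"
      then show "0 < N k" using strict_mono_imp_increasing[OF N, of k] by simp
      obtain Y A where Y: "finite Y" "Y \<noteq> {}" "\<And>y. y \<in> Y \<Longrightarrow> 0 < y \<and> y < \<infinity> \<and> A y \<in> \<B>"
        and card: "real (card {n \<in> {1..N k}. of_nat k <
          (\<Sum>y\<in>Y. y * S n (indicator (A y))) / (\<Sum>y\<in>Y. y * emeasure M (A y))}) \<ge> 1 / 2 * real (N k)"
        using N_large[of k] unfolding R_def by blast
      define r where "r = card Y"
      obtain e where e: "bij_betw e {1..r} Y"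
        using ex_bij_betw_nat_finite_1[OF Y(1)] unfolding r_def by blast
      have eY: "e j \<in> Y" if "j \<in> {1..r}" for j using e that by (auto simp: bij_betw_def)
      define i where "i j = to_nat_on \<B> (A (e j))" for j
      \<comment> \<open>The coefficients are the levels of the simple function; being finite and
        positive, they survive the passage to reals.\<close>
      define b where "b j = enn2real (e j)" for j
      have Bi: "B (i j) = A (e j)" if "j \<in> {1..r}" for j
        unfolding i_def using BI Y(3)[OF eY[OF that]] by blast
      have b: "ennreal (b j) = e j" "0 < b j" if "j \<in> {1..r}" for j
        using Y(3)[OF eY[OF that]] by (auto simp: b_def enn2real_positive_iff)
      have sum1: "(\<Sum>j=1..r. ennreal (b j) * emeasure M (B (i j))) = (\<Sum>y\<in>Y. y * emeasure M (A y))"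
        using sum.reindex_bij_betw[OF e, of "\<lambda>y. y * emeasure M (A y)"] by (simp add: b Bi)
      have sum2: "(\<Sum>j=1..r. ennreal (b j) * mu_iter p M w f n (preimage_iter M f n (B (i j))))
          = (\<Sum>y\<in>Y. y * S n (indicator (A y)))" for n
      proof -
        have "mu_iter p M w f n (preimage_iter M f n (A (e j))) = S n (indicator (A (e j)))"
          if "j \<in> {1..r}" for j
          using Y(3)[OF eY[OF that]] \<B>_props by (intro mu_iter_preimage) blast
        then show ?thesis
          using sum.reindex_bij_betw[OF e, of "\<lambda>y. y * S n (indicator (A y))"] by (simp add: b Bi)
      qed
      have "1 \<le> r" using Y(1,2) by (simp add: r_def Suc_le_eq card_gt_0_iff)
      moreover have "\<forall>j\<in>{1..r}. i j \<in> I \<and> b j > 0"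
        using b(2) Y(3)[OF eY] by (auto simp: I_def i_def)
      ultimately show "\<exists>(r::nat) (i :: nat \<Rightarrow> nat) (b :: nat \<Rightarrow> real).
             r \<ge> 1 \<and> (\<forall>j\<in>{1..r}. i j \<in> I \<and> b j > 0) \<and>
             real (card {n \<in> {1..N k}.
               (\<Sum>j=1..r. ennreal (b j) * mu_iter p M w f n (preimage_iter M f n (B (i j))))
                 / (\<Sum>j=1..r. ennreal (b j) * emeasure M (B (i j))) > of_nat k})
             \<ge> 1 / 2 * real (N k)"
        using card unfolding sum1[symmetric] sum2[symmetric] by blast
    qed simp
    ultimately show "\<exists>I B. I \<noteq> {} \<and> ?meas I B \<and> ?small I B \<and> ?large I B" by blast
  next
    assume "\<exists>I B. I \<noteq> {} \<and> ?meas I B \<and> ?small I B \<and> ?large I B"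
    then obtain I B where meas: "?meas I B" and small: "?small I B" and large: "?large I B" by blast
    from small obtain D where D: "upper_dens D = 1"
      and lim: "\<And>i. i \<in> I \<Longrightarrow> ((\<lambda>n. mu_iter p M w f n (preimage_iter M f n (B i))) \<longlongrightarrow> 0)
             (inf sequentially (principal D))" by blast
    have van: "indicator (B i) \<in> vanishing D" if "i \<in> I" for i
      using meas lim[OF that] that by (simp add: vanishing_def mu_iter_preimage borel_measurable_indicator)
    from large obtain \<epsilon> :: real and N where \<epsilon>: "0 < \<epsilon>" and N: "\<forall>k\<ge>1. N k > 0"
      and ratio: "\<forall>k\<ge>1. \<exists>(r::nat) (i :: nat \<Rightarrow> nat) (b :: nat \<Rightarrow> real).
             r \<ge> 1 \<and> (\<forall>j\<in>{1..r}. i j \<in> I \<and> b j > 0) \<and>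
             real (card {n \<in> {1..N k}.
               (\<Sum>j=1..r. ennreal (b j) * mu_iter p M w f n (preimage_iter M f n (B (i j))))
                 / (\<Sum>j=1..r. ennreal (b j) * emeasure M (B (i j))) > of_nat k})
             \<ge> \<epsilon> * real (N k)" by blast
    have "\<exists>g\<in>vanishing D. S 0 g \<le> 1 \<and>
      (\<exists>N\<ge>1. real (card {n \<in> {1..N}. of_nat k < S n g}) \<ge> \<epsilon> * real N)" for k :: nat
    proof -
      \<comment> \<open>Condition (b) starts at 1, whereas a function is wanted for every
        \<open>k\<close>, including 0; exceeding \<open>Suc k\<close> implies exceeding
        \<open>k\<close>.\<close>
      define K where "K = Suc k"
      have "1 \<le> K" by (simp add: K_def)
      with ratio obtain r :: nat and i :: "nat \<Rightarrow> nat" and b :: "nat \<Rightarrow> real"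
        where r: "r \<ge> 1" and ib: "\<And>j. j \<in> {1..r} \<Longrightarrow> i j \<in> I \<and> b j > 0"
        and card: "real (card {n \<in> {1..N K}.
               (\<Sum>j=1..r. ennreal (b j) * mu_iter p M w f n (preimage_iter M f n (B (i j))))
                 / (\<Sum>j=1..r. ennreal (b j) * emeasure M (B (i j))) > of_nat K})
             \<ge> \<epsilon> * real (N K)" by blast
      define q where "q = (\<Sum>j=1..r. ennreal (b j) * emeasure M (B (i j)))"
      \<comment> \<open>Dividing by \<open>q\<close> gives \<open>S 0 g\<close> the value 1 and
        makes \<open>S n g\<close> exactly the quotient in (b).\<close>
      define g where "g = (\<lambda>x. inverse q * (\<Sum>j=1..r. ennreal (b j) * indicator (B (i j)) x))"
      have B_sets: "B (i j) \<in> sets M" if "j \<in> {1..r}" for j using meas ib[OF that] by blast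
      have "ennreal (b 1) * emeasure M (B (i 1)) \<noteq> 0"
        using r ib[of 1] meas by (auto simp: less_le)
      then have q0: "q \<noteq> 0"
        unfolding q_def using r by (subst sum_eq_0_iff) (auto simp del: mult_eq_0_iff)
      have qfin: "q < top"
        unfolding q_def using meas ib by (auto simp: ennreal_mult_less_top)
      have g: "g \<in> vanishing D"
        unfolding g_def using q0 van ib
        by (intro vanishing_cmult vanishing_sum) (auto simp: less_top[symmetric])
      have Sg: "S n g = (\<Sum>j=1..r. ennreal (b j) * S n (indicator (B (i j)))) / q" for n
      proof -
        have term_measurable: "(\<lambda>x. ennreal (b j) * indicator (B (i j)) x) \<in> borel_measurable M"
          if "j \<in> {1..r}" for j
          using B_sets[OF that] by simp
        have "S n g = inverse q * S n (\<lambda>x. \<Sum>j=1..r. ennreal (b j) * indicator (B (i j)) x)"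
          unfolding g_def by (intro S_cmult borel_measurable_sum term_measurable)
        also have "S n (\<lambda>x. \<Sum>j=1..r. ennreal (b j) * indicator (B (i j)) x)
            = (\<Sum>j=1..r. S n (\<lambda>x. ennreal (b j) * indicator (B (i j)) x))"
          by (intro S_sum term_measurable)
        also have "\<dots> = (\<Sum>j=1..r. ennreal (b j) * S n (indicator (B (i j))))"
          using B_sets by (intro sum.cong S_cmult) auto
        finally show ?thesis by (simp add: divide_ennreal_def mult.commute)
      qed
      have "(\<Sum>j=1..r. ennreal (b j) * S 0 (indicator (B (i j)))) = q"
        unfolding q_def using B_sets by (intro sum.cong) (auto simp: S_0)
      then have "S 0 g \<le> 1" unfolding Sg using q0 qfin by simp
      moreover have "real (card {n \<in> {1..N K}. of_nat k < S n g}) \<ge> \<epsilon> * real (N K)"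
      proof -
        have "S n g = (\<Sum>j=1..r. ennreal (b j) * mu_iter p M w f n (preimage_iter M f n (B (i j)))) / q" for n
          unfolding Sg using B_sets by (simp add: mu_iter_preimage)
        moreover have "of_nat k < a" if "of_nat K < a" for a :: ennreal
          using that by (rule le_less_trans[rotated]) (simp add: K_def)
        ultimately have "{n \<in> {1..N K}.
               (\<Sum>j=1..r. ennreal (b j) * mu_iter p M w f n (preimage_iter M f n (B (i j))))
                 / (\<Sum>j=1..r. ennreal (b j) * emeasure M (B (i j))) > of_nat K}
            \<subseteq> {n \<in> {1..N K}. of_nat k < S n g}"
          unfolding q_def[symmetric] by auto
        from card_mono[OF _ this] card show ?thesis by simp
      qed
      moreover have "N K \<ge> 1" using N by (simp add: K_def Suc_le_eq)
      ultimately show ?thesis using g by blast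
    qed
    from D \<epsilon> this show "distributionally_chaotic (Lp_space p M) (Lp_dist p M) (wcomp_op p M w f)"
      by (rule irregular_function) (rule distributionally_chaotic_of_irregular)
  qed
qed

end
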